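(* For any $\lambda,\eta\in(0,1)$ and any $0<\beta<\alpha<1$ there exists a single reservoir distribution $\mu$ satisfying $G_\mu^{-1}(1-\eta)=\alpha$ such that for any sequence $(\mathcal{A}_N)_{N\ge1}$ where each $\mathcal{A}_N$ is an $N$-sample algorithm (possibly depending on $\mu$), letting $a_{i^*}$ be the output of $\mathcal{A}_N$ run on reservoir $\mu$, \[ \liminf_{N\to\infty}\frac{\big(-\log\mathbb{P}[p_{i^*}<\beta]\big)\cdot\log^2N}{N}\ \le\ c_{\alpha,\beta}+\lambda, \qquad c_{\alpha,\beta}=\frac{\big(\arccos(1-2\alpha)-\arccos(1-2\beta)\big)^2}{2}. \]
   Context: Infinite-armed Bernoulli bandit: a reservoir distribution $\mu$ is any Borel probability measure on $[0,1]$. There are countably many arms $a_1,a_2,\dots$ whose means $p_1,p_2,\dots$ are drawn i.i.d. from $\mu$. Each time arm $a_i$ is sampled it returns a reward in $\{0,1\}$ distributed as Bernoulli$(p_i)$, independently of all other rewards given the means. An algorithm, at each step, chooses (based on previously observed rewards and possibly internal randomness) an arm to sample, and at the end outputs an arm index $i^*$. An $N$-sample algorithm is one that takes exactly $N$ samples almost surely and then outputs $i^*$. Probabilities are over the means, rewards and algorithm randomness. $G_\mu(\tau)=\mu([0,\tau])$ and $G_\mu^{-1}(p)=\inf\{\tau:G_\mu(\tau)\ge p\}$. *)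

theory Defs
  imports "HOL-Probability.Probability"
begin

definition reservoir :: "real measure \<Rightarrow> bool" where
  "reservoir \<mu> \<longleftrightarrow> prob_space \<mu> \<and> sets \<mu> = sets borel \<and> measure \<mu> {0..1} = 1"

definition G :: "real measure \<Rightarrow> real \<Rightarrow> real" where
  "G \<mu> \<tau> = measure \<mu> {0..\<tau>}"

definition Ginv :: "real measure \<Rightarrow> real \<Rightarrow> real" where
  "Ginv \<mu> q = Inf {\<tau>. G \<mu> \<tau> \<ge> q}"

text \<open>An algorithm step rule: given the internal random seed u (uniform on [0,1]) and the
  history of (arm index, reward) pairs observed so far, the arm to sample next.
  The output rule has the same shape.  History after t samples; the k-th pull
  (0-based) of arm i returns the reward [V(i,k) < p i], V i.i.d. uniform.\<close>
fun hist :: "(real \<Rightarrow> (nat \<times> bool) list \<Rightarrow> nat) \<Rightarrow> real \<Rightarrow> (nat \<Rightarrow> real)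
    \<Rightarrow> (nat \<times> nat \<Rightarrow> real) \<Rightarrow> nat \<Rightarrow> (nat \<times> bool) list" where
  "hist ch u p V 0 = []"
| "hist ch u p V (Suc t) =
     (let h = hist ch u p V t; i = ch u h; k = length (filter (\<lambda>x. fst x = i) h)
      in h @ [(i, V (i, k) < p i)])"

definition unif01 :: "real measure" where
  "unif01 = uniform_measure lborel {0..1}"

text \<open>Joint probability space: seed, arm means i.i.d. from mu, reward uniforms.\<close>
definition bandit_space :: "real measure \<Rightarrow> (real \<times> (nat \<Rightarrow> real) \<times> (nat \<times> nat \<Rightarrow> real)) measure" where
  "bandit_space \<mu> = unif01 \<Otimes>\<^sub>M ((PiM UNIV (\<lambda>_::nat. \<mu>)) \<Otimes>\<^sub>M (PiM UNIV (\<lambda>_::nat \<times> nat. unif01)))"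

definition measurable_alg ::
  "(real \<Rightarrow> (nat \<times> bool) list \<Rightarrow> nat) \<Rightarrow> (real \<Rightarrow> (nat \<times> bool) list \<Rightarrow> nat) \<Rightarrow> bool" where
  "measurable_alg ch out \<longleftrightarrow>
     (\<forall>h. (\<lambda>u. ch u h) \<in> borel \<rightarrow>\<^sub>M count_space UNIV) \<and>
     (\<forall>h. (\<lambda>u. out u h) \<in> borel \<rightarrow>\<^sub>M count_space UNIV)"

definition prob_bad :: "real measure \<Rightarrow> real \<Rightarrow> (real \<Rightarrow> (nat \<times> bool) list \<Rightarrow> nat)
    \<Rightarrow> (real \<Rightarrow> (nat \<times> bool) list \<Rightarrow> nat) \<Rightarrow> nat \<Rightarrow> real" where
  "prob_bad \<mu> \<beta> ch out N = measure (bandit_space \<mu>)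
     {\<omega> \<in> space (bandit_space \<mu>). case \<omega> of (u, p, V) \<Rightarrow> p (out u (hist ch u p V N)) < \<beta>}"

definition rate :: "real measure \<Rightarrow> real \<Rightarrow> (real \<Rightarrow> (nat \<times> bool) list \<Rightarrow> nat)
    \<Rightarrow> (real \<Rightarrow> (nat \<times> bool) list \<Rightarrow> nat) \<Rightarrow> nat \<Rightarrow> ereal" where
  "rate \<mu> \<beta> ch out N = (let P = prob_bad \<mu> \<beta> ch out N in
     if P = 0 then \<infinity> else ereal ((- ln P) * (ln (real N))^2 / real N))"

definition c_const :: "real \<Rightarrow> real \<Rightarrow> real" where
  "c_const \<alpha> \<beta> = (arccos (1 - 2*\<alpha>) - arccos (1 - 2*\<beta>))^2 / 2"

end

theory Submission
  imports Defs "HOL-Real_Asymp.Real_Asymp"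
begin

text \<open>The reservoir is uniform from slightly below \<open>\<beta>\<close> to \<open>\<alpha>\<close>, plus an atom at \<open>\<alpha>\<close>. The
  failure scenario makes every arm look as if its mean decayed slowly with the number \<open>s\<close> of
  pulls: on the angle scale \<open>arccos (1 - 2 * p)\<close>, on which Bernoulli laws have Fisher
  information one, it moves linearly in \<open>ln s\<close> from \<open>\<alpha>\<close> to slightly below \<open>\<beta>\<close> while
  \<open>s\<close> runs through polylogarithmic values up to a power of \<open>N\<close> slightly less than one. An arm
  abandoned after \<open>s\<close> pulls is explained by a constant mean, the average of the apparent
  means, at the cost of \<open>b\<^sup>2 / 2\<close> per pull, where \<open>b\<close> is the angle distance divided by (almost)
  \<open>ln N\<close>; summed over \<open>N\<close> pulls this is the claimed exponent. An output arm with few pulls is moved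
  below \<open>\<beta>\<close> at negligible cost, and one with many pulls lies below \<open>\<beta>\<close> already.\<close>

section \<open>Histories and likelihoods\<close>

text \<open>The obstacle is adaptivity: how often an arm is pulled depends on its own rewards, while
  the true law offers only constant means. Both are met by a weight that sees an arm only through
  its counts of wins and losses. It stays below the probability of those rewards averaged over the
  reservoir, and a further pull, of whichever arm, keeps at least the fraction
  \<open>exp (- cost)\<close> of the product of weights over the arms. So the total weight after
  \<open>N\<close> pulls is at least \<open>exp (- cost) ^ N\<close> for every algorithm, and no law
  of a fictitious bandit has to be constructed.

  The budget per pull is of order 1 / ln^2 N and must be met with the sharp constant, so all other
  terms of \<open>cost\<close> have to be of lower order. With \<open>b\<close> of order 1 / ln N,
  the choice \<open>A\<close> = ln N makes \<open>b\<^sup>2 / A\<close> small enough, and then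
  \<open>A / s0\<close> and \<open>\<rho>\<close>, of order ln N / \<open>s0\<close>, force
  \<open>s0\<close> beyond ln^3 N; it is taken as ln^4 N.

  Two slacks are paid from \<open>lam\<close>: ending below \<beta> keeps a fixed reservoir mass
  between the end point and \<beta>, and a power of \<open>N\<close> below one makes moving the
  output arm cheap.\<close>

fun histories :: "((nat \<times> bool) list \<Rightarrow> nat) \<Rightarrow> nat \<Rightarrow> (nat \<times> bool) list set" where
  "histories c 0 = {[]}"
| "histories c (Suc t) = (\<lambda>(h, r). h @ [(c h, r)]) ` (histories c t \<times> UNIV)"

definition pulls :: "nat \<Rightarrow> (nat \<times> bool) list \<Rightarrow> nat" where
  "pulls i h = length (filter (\<lambda>x. fst x = i) h)"

definition outcomes :: "bool \<Rightarrow> nat \<Rightarrow> (nat \<times> bool) list \<Rightarrow> nat" where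
  "outcomes r i h = length (filter (\<lambda>x. x = (i, r)) h)"

definition likelihood :: "(nat \<Rightarrow> real) \<Rightarrow> (nat \<times> bool) list \<Rightarrow> real" where
  "likelihood p h = (\<Prod>x\<leftarrow>h. if snd x then p (fst x) else 1 - p (fst x))"

lemma finite_histories: "finite (histories c N)"
  by (induction N) auto

lemma pulls_simps [simp]:
  "pulls i [] = 0" "pulls i (h @ [(j, r)]) = pulls i h + (if j = i then 1 else 0)"
  by (auto simp: pulls_def)

lemma outcomes_simps [simp]:
  "outcomes r i [] = 0"
  "outcomes r i (h @ [(j, r')]) = outcomes r i h + (if j = i \<and> r' = r then 1 else 0)"
  by (auto simp: outcomes_def)

lemma likelihood_simps [simp]:
  "likelihood p [] = 1"
  "likelihood p (h @ [(j, r)]) = likelihood p h * (if r then p j else 1 - p j)"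
  by (auto simp: likelihood_def)

lemma outcomes_sum: "outcomes True i h + outcomes False i h = pulls i h"
  by (induction h rule: rev_induct) auto

lemma pulls_le_length: "pulls i h \<le> length h"
  by (simp add: pulls_def)

lemma length_histories: "h \<in> histories c N \<Longrightarrow> length h = N"
  by (induction N arbitrary: h) auto

lemma hist_in_histories: "hist ch u p V N \<in> histories (ch u) N"
  by (induction N) (auto simp: Let_def image_iff)

text \<open>The cells of the reward table that a run with history \<open>h\<close> reads:
  \<open>hist\<close> looks up cell \<open>(i, k)\<close> at the pull of arm \<open>i\<close> that
  has \<open>k\<close> predecessors.\<close>

definition pull_indices :: "(nat \<times> bool) list \<Rightarrow> (nat \<times> nat) set" where
  "pull_indices h = {(i, k). k < pulls i h}"

text \<open>Only the values on \<open>pull_indices h\<close> carry meaning; elsewhere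
  \<open>!\<close> runs past the end of the list.\<close>

definition pull_result :: "(nat \<times> bool) list \<Rightarrow> nat \<times> nat \<Rightarrow> bool" where
  "pull_result h j = snd (filter (\<lambda>x. fst x = fst j) h ! snd j)"

lemma pull_indices_snoc:
  "pull_indices (h @ [(i, r)]) = insert (i, pulls i h) (pull_indices h)"
  by (auto simp: pull_indices_def split: if_splits)

lemma pull_indices_Nil [simp]: "pull_indices [] = {}"
  by (simp add: pull_indices_def)

lemma finite_pull_indices: "finite (pull_indices h)"
proof (induction h rule: rev_induct)
  case (snoc x h) then show ?case by (cases x) (simp add: pull_indices_snoc)
qed simp

lemma fresh_pull_index: "(i, pulls i h) \<notin> pull_indices h"
  by (simp add: pull_indices_def)

lemma pull_result_snoc_new: "pull_result (h @ [(i, r)]) (i, pulls i h) = r"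
  by (simp add: pull_result_def pulls_def)

lemma pull_result_snoc_old:
  "j \<in> pull_indices h \<Longrightarrow> pull_result (h @ [(i, r)]) j = pull_result h j"
  by (cases j) (auto simp: pull_result_def pull_indices_def pulls_def nth_append)

text \<open>Every pull reads a fresh cell, so a history imposes one separate condition on each cell
  it reads. The event is thus a finite box in the product space, although the cells are chosen
  adaptively.\<close>

lemma hist_eq_iff:
  assumes "h \<in> histories (ch u) N"
  shows "hist ch u p V N = h \<longleftrightarrow>
    (\<forall>j\<in>pull_indices h. (V j < p (fst j)) = pull_result h j)"
  using assms
proof (induction N arbitrary: h)
  case (Suc N)
  then obtain h0 r where h0: "h0 \<in> histories (ch u) N" and h: "h = h0 @ [(ch u h0, r)]"
    by auto
  have "hist ch u p V (Suc N) = h \<longleftrightarrow>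
      hist ch u p V N = h0 \<and> (V (ch u h0, pulls (ch u h0) h0) < p (ch u h0)) = r"
    by (auto simp: Let_def h pulls_def)
  then show ?case
    using Suc.IH[OF h0]
    by (auto simp: h pull_indices_snoc pull_result_snoc_new pull_result_snoc_old simp del: hist.simps)
qed simp

section \<open>Probability of a history given the means\<close>

lemma prob_space_unif01: "prob_space unif01"
  unfolding unif01_def by (rule prob_space_uniform_measure) auto

lemma sets_unif01 [simp, measurable_cong]: "sets unif01 = sets borel"
  by (simp add: unif01_def)

lemma space_unif01 [simp]: "space unif01 = UNIV"
  by (simp add: unif01_def)

lemma emeasure_unif01_less:
  assumes "0 \<le> x" "x \<le> 1"
  shows "emeasure unif01 {v. (v < x) = r} = ennreal (if r then x else 1 - x)"
proof -
  have "{0..1} \<inter> {v. (v < x) = r} = (if r then {0..<x} else {x..1})"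
    using assms by auto
  moreover have "{v. (v < x) = r} = (if r then {..<x} else {x..})" by auto
  ultimately show ?thesis
    using assms by (simp add: unif01_def emeasure_uniform_measure divide_ennreal_def)
qed

lemma prob_pull_results:
  assumes p: "\<And>i. p i \<in> {0..1::real}"
  shows "(\<Prod>j\<in>pull_indices h. emeasure unif01 {v. (v < p (fst j)) = pull_result h j})
    = ennreal (likelihood p h)"
proof (induction h rule: rev_induct)
  case (snoc x h)
  obtain i r where x: "x = (i, r)" by (cases x)
  have nn: "0 \<le> likelihood p h"
    unfolding likelihood_def using p by (intro prod_list_nonneg) auto
  have "(\<Prod>j\<in>pull_indices h. emeasure unif01 {v. (v < p (fst j)) = pull_result (h @ [(i, r)]) j})
    = (\<Prod>j\<in>pull_indices h. emeasure unif01 {v. (v < p (fst j)) = pull_result h j})"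
    by (intro prod.cong) (auto simp: pull_result_snoc_old)
  moreover have "emeasure unif01 {v. (v < p i) = r} = ennreal (if r then p i else 1 - p i)"
    using p[of i] by (intro emeasure_unif01_less) auto
  ultimately show ?case
    using p[of i] nn
    by (simp add: x pull_indices_snoc finite_pull_indices fresh_pull_index pull_result_snoc_new
        snoc.IH ennreal_mult mult.commute)
qed simp

text \<open>The choice rule contributes no factor: once the seed is fixed, its choices are
  determined by the rewards seen so far.\<close>

lemma emeasure_hist_eq:
  assumes p: "\<And>i. p i \<in> {0..1}" and h: "h \<in> histories (ch u) N"
  defines "PV \<equiv> PiM UNIV (\<lambda>_::nat \<times> nat. unif01)"
  shows "emeasure PV {V \<in> space PV. hist ch u p V N = h} = ennreal (likelihood p h)"
proof -
  interpret product_prob_space "\<lambda>_::nat \<times> nat. unif01" UNIV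
    by (simp add: product_prob_space_def product_prob_space_axioms_def product_sigma_finite_def
        prob_space_unif01 prob_space_imp_sigma_finite)
  have m: "{v. (v < p (fst j)) = pull_result h j} \<in> sets unif01" for j
    by (cases "pull_result h j") auto
  have "{V \<in> space PV. hist ch u p V N = h}
    = {V \<in> space PV. \<forall>j\<in>pull_indices h. V j \<in> {v. (v < p (fst j)) = pull_result h j}}"
    using hist_eq_iff[of h ch u N p] h by auto
  then show ?thesis
    unfolding PV_def
    using emeasure_PiM_Collect[of "pull_indices h" "\<lambda>j. {v. (v < p (fst j)) = pull_result h j}"]
      finite_pull_indices m prob_pull_results[OF p] by simp
qed

section \<open>From one arm to all arms\<close>

lemma likelihood_arms:
  assumes "finite I" "fst ` set h \<subseteq> I"
  shows "likelihood p h = (\<Prod>i\<in>I. p i ^ outcomes True i h * (1 - p i) ^ outcomes False i h)"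
  using assms(2)
proof (induction h rule: rev_induct)
  case (snoc x h)
  obtain i r where x: "x = (i, r)" by (cases x)
  with snoc have i: "i \<in> I" and hI: "fst ` set h \<subseteq> I" by auto
  let ?g = "\<lambda>h i. p i ^ outcomes True i h * (1 - p i) ^ outcomes False i h"
  have "(\<Prod>j\<in>I. ?g (h @ [x]) j) = ?g (h @ [x]) i * (\<Prod>j\<in>I - {i}. ?g (h @ [x]) j)"
    using assms(1) i by (rule prod.remove)
  also have "(\<Prod>j\<in>I - {i}. ?g (h @ [x]) j) = (\<Prod>j\<in>I - {i}. ?g h j)"
    by (intro prod.cong) (auto simp: x)
  also have "?g (h @ [x]) i = (if r then p i else 1 - p i) * ?g h i"
    by (simp add: x)
  also have "(if r then p i else 1 - p i) * ?g h i * (\<Prod>j\<in>I - {i}. ?g h j)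
      = (if r then p i else 1 - p i) * (\<Prod>j\<in>I. ?g h j)"
    using assms(1) i by (simp add: prod.remove)
  finally show ?case using snoc.IH[OF hI] by (simp add: x)
qed simp

lemma nn_integral_PiM_prod:
  fixes g :: "'i \<Rightarrow> 'a \<Rightarrow> ennreal"
  assumes \<mu>: "prob_space \<mu>" and I: "finite I" and g: "\<And>i. i \<in> I \<Longrightarrow> g i \<in> borel_measurable \<mu>"
  shows "(\<integral>\<^sup>+p. (\<Prod>i\<in>I. g i (p i)) \<partial>PiM UNIV (\<lambda>_::'i. \<mu>)) = (\<Prod>i\<in>I. \<integral>\<^sup>+x. g i x \<partial>\<mu>)"
proof -
  interpret product_prob_space "\<lambda>_::'i. \<mu>" UNIV
    by (simp add: product_prob_space_def product_prob_space_axioms_def product_sigma_finite_def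
        \<mu> prob_space_imp_sigma_finite)
  have gm: "(\<lambda>p. \<Prod>i\<in>I. g i (p i)) \<in> borel_measurable (PiM I (\<lambda>_. \<mu>))"
    using g by (intro borel_measurable_prod_ennreal) (auto intro: measurable_compose[OF measurable_component_singleton])
  have "(\<Prod>i\<in>I. \<integral>\<^sup>+x. g i x \<partial>\<mu>) = (\<integral>\<^sup>+p. (\<Prod>i\<in>I. g i (p i)) \<partial>PiM I (\<lambda>_. \<mu>))"
    using g by (intro product_nn_integral_prod[symmetric] I) auto
  also have "PiM I (\<lambda>_. \<mu>) = distr (PiM UNIV (\<lambda>_. \<mu>)) (PiM I (\<lambda>_. \<mu>)) (\<lambda>x. restrict x I)"
    by (rule distr_PiM_restrict_finite[symmetric]) (auto simp: I)
  also have "(\<integral>\<^sup>+p. (\<Prod>i\<in>I. g i (p i)) \<partial>\<dots>) = (\<integral>\<^sup>+p. (\<Prod>i\<in>I. g i (restrict p I i)) \<partial>PiM UNIV (\<lambda>_::'i. \<mu>))"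
    using gm by (intro nn_integral_distr) (auto intro!: measurable_restrict_subset)
  also have "\<dots> = (\<integral>\<^sup>+p. (\<Prod>i\<in>I. g i (p i)) \<partial>PiM UNIV (\<lambda>_::'i. \<mu>))"
    by (intro nn_integral_cong prod.cong) auto
  finally show ?thesis by simp
qed

text \<open>A pull changes the counts of one arm only, hence one factor of the product. The one-arm
  inequality \<open>step\<close>, multiplied by the other nonnegative factors, shows that branching
  on the reward keeps at least the fraction \<open>a\<close> of the weight of each history.\<close>

lemma sum_histories_ge:
  fixes \<Lambda> :: "nat \<Rightarrow> nat \<Rightarrow> real"
  assumes I: "finite I" and c: "\<And>t h. t < N \<Longrightarrow> h \<in> histories c t \<Longrightarrow> c h \<in> I"
    and zero: "\<Lambda> 0 0 = 1" and nn: "\<And>k l. k + l \<le> N \<Longrightarrow> 0 \<le> \<Lambda> k l"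
    and step: "\<And>k l. k + l < N \<Longrightarrow> a * \<Lambda> k l \<le> \<Lambda> (Suc k) l + \<Lambda> k (Suc l)"
    and a: "0 \<le> a"
    and t: "t \<le> N"
  shows "a ^ t \<le> (\<Sum>h\<in>histories c t. \<Prod>i\<in>I. \<Lambda> (outcomes True i h) (outcomes False i h))"
  using t
proof (induction t)
  case 0
  then show ?case by (simp add: zero)
next
  case (Suc t)
  let ?w = "\<lambda>h i. \<Lambda> (outcomes True i h) (outcomes False i h)"
  have inj: "inj_on (\<lambda>(h, r). h @ [(c h, r)]) (histories c t \<times> UNIV)"
    by (auto simp: inj_on_def)
  have one: "a * (\<Prod>i\<in>I. ?w h i) \<le> (\<Sum>r\<in>UNIV. \<Prod>i\<in>I. ?w (h @ [(c h, r)]) i)"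
    if h: "h \<in> histories c t" for h
  proof -
    have ci: "c h \<in> I" using c[of t h] h Suc.prems by simp
    have len: "length h = t" using h by (rule length_histories)
    have le: "outcomes True i h + outcomes False i h \<le> t" for i
      using outcomes_sum[of i h] pulls_le_length[of i h] len by simp
    have nnw: "0 \<le> ?w h i" for i
      using le[of i] Suc.prems by (intro nn) simp
    have split: "(\<Prod>i\<in>I. ?w (h @ [(c h, r)]) i)
        = ?w (h @ [(c h, r)]) (c h) * (\<Prod>i\<in>I - {c h}. ?w h i)" for r
    proof -
      have "(\<Prod>i\<in>I - {c h}. ?w (h @ [(c h, r)]) i) = (\<Prod>i\<in>I - {c h}. ?w h i)"
        by (intro prod.cong) auto
      then show ?thesis using prod.remove[OF I ci, of "?w (h @ [(c h, r)])"] by simp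
    qed
    have "a * (\<Prod>i\<in>I. ?w h i) = (a * ?w h (c h)) * (\<Prod>i\<in>I - {c h}. ?w h i)"
      using prod.remove[OF I ci, of "?w h"] by simp
    also have "\<dots> \<le> (?w (h @ [(c h, True)]) (c h) + ?w (h @ [(c h, False)]) (c h))
        * (\<Prod>i\<in>I - {c h}. ?w h i)"
      using step[of "outcomes True (c h) h" "outcomes False (c h) h"] le[of "c h"] Suc.prems nnw
      by (intro mult_right_mono prod_nonneg) auto
    also have "\<dots> = (\<Sum>r\<in>UNIV. \<Prod>i\<in>I. ?w (h @ [(c h, r)]) i)"
      unfolding split by (simp add: UNIV_bool algebra_simps)
    finally show ?thesis .
  qed
  have "a ^ Suc t \<le> a * (\<Sum>h\<in>histories c t. \<Prod>i\<in>I. ?w h i)"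
    using Suc a by (simp add: mult_left_mono)
  also have "\<dots> \<le> (\<Sum>h\<in>histories c t. \<Sum>r\<in>UNIV. \<Prod>i\<in>I. ?w (h @ [(c h, r)]) i)"
    unfolding sum_distrib_left by (intro sum_mono one)
  also have "\<dots> = (\<Sum>(h, r)\<in>histories c t \<times> UNIV. \<Prod>i\<in>I. ?w (h @ [(c h, r)]) i)"
    by (rule sum.cartesian_product)
  also have "\<dots> = (\<Sum>h\<in>histories c (Suc t). \<Prod>i\<in>I. ?w h i)"
    by (simp only: histories.simps case_prod_unfold sum.reindex[OF inj[unfolded case_prod_unfold]] o_def)
  finally show ?case .
qed

section \<open>Measurability, and the bound for an arbitrary algorithm\<close>

lemma measurable_hist:
  assumes ch: "\<And>h. (\<lambda>u. ch u h) \<in> borel \<rightarrow>\<^sub>M count_space UNIV" and \<mu>: "sets \<mu> = sets borel"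
  shows "(\<lambda>(u, p, V). hist ch u p V N) \<in> bandit_space \<mu> \<rightarrow>\<^sub>M count_space UNIV"
proof -
  note [measurable_cong] = \<mu>
  have ch' [measurable]: "(\<lambda>\<omega>. ch (fst \<omega>) h) \<in> bandit_space \<mu> \<rightarrow>\<^sub>M count_space UNIV" for h
    unfolding bandit_space_def
    by (rule measurable_compose[OF _ ch]) (simp add: measurable_fst'' cong: measurable_cong_sets)
  have [measurable]: "(\<lambda>\<omega>. fst (snd \<omega>) i) \<in> bandit_space \<mu> \<rightarrow>\<^sub>M borel"
    "(\<lambda>\<omega>. snd (snd \<omega>) j) \<in> bandit_space \<mu> \<rightarrow>\<^sub>M borel" for i j
    unfolding bandit_space_def by measurable
  have "(\<lambda>\<omega>. hist ch (fst \<omega>) (fst (snd \<omega>)) (snd (snd \<omega>)) N) \<in> bandit_space \<mu> \<rightarrow>\<^sub>M count_space UNIV"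
  proof (induction N)
    case (Suc N)
    \<comment> \<open>The past history and the chosen arm are both random but range over countable
      types, so each is first frozen at a single value.\<close>
    define next_hist where "next_hist h i \<omega> =
      h @ [(i, snd (snd \<omega>) (i, pulls i h) < fst (snd \<omega>) i)]"
      for h i and \<omega> :: "real \<times> (nat \<Rightarrow> real) \<times> (nat \<times> nat \<Rightarrow> real)"
    have reward: "(\<lambda>\<omega>. snd (snd \<omega>) (i, pulls i h) < fst (snd \<omega>) i)
        \<in> bandit_space \<mu> \<rightarrow>\<^sub>M count_space UNIV" for h i
      by measurable
    have "next_hist h i \<in> bandit_space \<mu> \<rightarrow>\<^sub>M count_space UNIV" for h i
      unfolding next_hist_def
      by (rule measurable_compose[OF reward, where g = "\<lambda>r. h @ [(i, r)]"]) simp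
    then have "(\<lambda>\<omega>. next_hist h (ch (fst \<omega>) h) \<omega>) \<in> bandit_space \<mu> \<rightarrow>\<^sub>M count_space UNIV" for h
      by (rule measurable_compose_countable[where f = "next_hist h", OF _ ch'])
    from measurable_compose_countable[where f = "\<lambda>h \<omega>. next_hist h (ch (fst \<omega>) h) \<omega>", OF this Suc.IH]
    show ?case by (simp only: hist.simps Let_def pulls_def next_hist_def)
  qed simp
  then show ?thesis by (simp add: case_prod_beta)
qed

text \<open>Given the seed, the probability of a history is a product over the arms of integrals
  \<open>\<integral>x. x ^ k * (1 - x) ^ l \<partial>\<mu>\<close>, so a one-arm submartingale below these integrals bounds
  the sum over all histories, whatever the algorithm does.\<close>

lemma prob_bad_ge:
  fixes \<Lambda> :: "nat \<Rightarrow> nat \<Rightarrow> real"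
  assumes \<mu>: "reservoir \<mu>" and alg: "measurable_alg ch out"
    and zero: "\<Lambda> 0 0 = 1" and nn: "\<And>k l. k + l \<le> N \<Longrightarrow> 0 \<le> \<Lambda> k l"
    and step: "\<And>k l. k + l < N \<Longrightarrow> a * \<Lambda> k l \<le> \<Lambda> (Suc k) l + \<Lambda> k (Suc l)"
    and a: "0 \<le> a"
    and le: "\<And>k l. k + l \<le> N \<Longrightarrow> \<Lambda> k l \<le> (\<integral>x. x ^ k * (1 - x) ^ l \<partial>\<mu>)"
    and bad: "\<And>k l. k + l \<le> N \<Longrightarrow>
      \<theta> * \<Lambda> k l \<le> (\<integral>x. x ^ k * (1 - x) ^ l * indicator {..<\<beta>} x \<partial>\<mu>)"
    and \<theta>: "0 \<le> \<theta>"
  shows "\<theta> * a ^ N \<le> prob_bad \<mu> \<beta> ch out N"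
proof -
  define PP where "PP = PiM UNIV (\<lambda>_::nat. \<mu>)"
  define PV where "PV = PiM UNIV (\<lambda>_::nat \<times> nat. unif01)"
  have prob: "prob_space \<mu>" and sets_\<mu> [measurable_cong]: "sets \<mu> = sets borel"
    and m1: "measure \<mu> {0..1} = 1"
    using \<mu> by (auto simp: reservoir_def)
  interpret \<mu>: prob_space \<mu> by (rule prob)
  interpret U: prob_space unif01 by (rule prob_space_unif01)
  interpret PP: prob_space PP unfolding PP_def by (intro prob_space_PiM prob)
  interpret PV: prob_space PV unfolding PV_def by (intro prob_space_PiM prob_space_unif01)
  interpret R: pair_prob_space PP PV ..
  interpret W: pair_prob_space unif01 "PP \<Otimes>\<^sub>M PV" ..
  have space_\<mu> [simp]: "space \<mu> = UNIV" using sets_eq_imp_space_eq[OF sets_\<mu>] by simp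
  have space_PP [simp]: "space PP = UNIV" by (simp add: PP_def space_PiM)
  have space_PV [simp]: "space PV = UNIV" by (simp add: PV_def space_PiM)
  have BS: "bandit_space \<mu> = unif01 \<Otimes>\<^sub>M (PP \<Otimes>\<^sub>M PV)"
    by (simp add: bandit_space_def PP_def PV_def)
  have ch: "(\<lambda>u. ch u h) \<in> borel \<rightarrow>\<^sub>M count_space UNIV" for h
    using alg by (simp add: measurable_alg_def)
  have out: "(\<lambda>u. out u h) \<in> borel \<rightarrow>\<^sub>M count_space UNIV" for h
    using alg by (simp add: measurable_alg_def)
  have hist_m: "(\<lambda>\<omega>. hist ch (fst \<omega>) (fst (snd \<omega>)) (snd (snd \<omega>)) N)
      \<in> bandit_space \<mu> \<rightarrow>\<^sub>M count_space UNIV"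
    using measurable_hist[of ch \<mu> N, OF ch sets_\<mu>] by (simp only: case_prod_unfold)
  define B where "B = {\<omega> \<in> space (bandit_space \<mu>).
    case \<omega> of (u, p, V) \<Rightarrow> p (out u (hist ch u p V N)) < \<beta>}"
  have B: "B \<in> sets (unif01 \<Otimes>\<^sub>M (PP \<Otimes>\<^sub>M PV))"
  proof -
    have out': "(\<lambda>\<omega>. out (fst \<omega>) h) \<in> bandit_space \<mu> \<rightarrow>\<^sub>M count_space UNIV" for h
      unfolding BS
      by (rule measurable_compose[OF _ out]) (simp add: measurable_fst'' cong: measurable_cong_sets)
    have arm: "(\<lambda>\<omega>. out (fst \<omega>) (hist ch (fst \<omega>) (fst (snd \<omega>)) (snd (snd \<omega>)) N))
        \<in> bandit_space \<mu> \<rightarrow>\<^sub>M count_space UNIV"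
      by (rule measurable_compose_countable[where f = "\<lambda>h \<omega>. out (fst \<omega>) h", OF out' hist_m])
    have mean: "(\<lambda>\<omega>. fst (snd \<omega>) i) \<in> bandit_space \<mu> \<rightarrow>\<^sub>M borel" for i
      unfolding BS PP_def by measurable
    have "(\<lambda>\<omega>. fst (snd \<omega>) (out (fst \<omega>) (hist ch (fst \<omega>) (fst (snd \<omega>)) (snd (snd \<omega>)) N)))
        \<in> borel_measurable (bandit_space \<mu>)"
      by (rule measurable_compose_countable[where f = "\<lambda>i \<omega>. fst (snd \<omega>) i", OF mean arm])
    then have "{\<omega> \<in> space (bandit_space \<mu>).
        fst (snd \<omega>) (out (fst \<omega>) (hist ch (fst \<omega>) (fst (snd \<omega>)) (snd (snd \<omega>)) N)) < \<beta>}
        \<in> sets (bandit_space \<mu>)"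
      by measurable
    then show ?thesis by (simp only: B_def BS case_prod_unfold)
  qed
  \<comment> \<open>The bound is proved for every single seed, so internal randomness cannot help;
    the seed is integrated out at the end.\<close>
  have fixed_seed: "ennreal (\<theta> * a ^ N) \<le> emeasure (PP \<Otimes>\<^sub>M PV) (Pair u -` B)" for u
  proof -
    define H where "H = histories (ch u) N"
    have finH: "finite H" by (simp add: H_def finite_histories)
    \<comment> \<open>With the seed fixed, only finitely many arms can be sampled or output within
      \<open>N\<close> steps, which replaces the infinite family of means by a finite
      product.\<close>
    define I where "I = (\<Union>t\<le>N. \<Union>h\<in>histories (ch u) t. {ch u h, out u h} \<union> fst ` set h)"
    have finI: "finite I" by (auto simp: I_def finite_histories)
    \<comment> \<open>Given the history, failure is a condition on the mean of the output arm alone,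
      so it enters as an indicator in that one factor.\<close>
    define g where "g h i x = ennreal (x ^ outcomes True i h * (1 - x) ^ outcomes False i h
      * indicator (if i = out u h then {..<\<beta>} else UNIV) x)" for h i and x :: real
    define w where "w h i = \<Lambda> (outcomes True i h) (outcomes False i h)" for h i
    have g_m [measurable]: "g h i \<in> borel_measurable \<mu>" for h i
      unfolding g_def by measurable
    have Bu: "Pair u -` B \<in> sets (PP \<Otimes>\<^sub>M PV)"
      using B by (rule sets_Pair1)
    have sum_g: "(\<Sum>h\<in>H. \<Prod>i\<in>I. g h i (p i)) \<le> emeasure PV (Pair p -` (Pair u -` B))"
      if p: "\<And>i. p i \<in> {0..1}" for p
    proof -
      define E where "E h = {V \<in> space PV. hist ch u p V N = h}" for h
      have "(\<lambda>V. (u, p, V)) \<in> PV \<rightarrow>\<^sub>M bandit_space \<mu>"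
        unfolding BS by measurable
      from measurable_compose[OF this hist_m]
      have "(\<lambda>V. hist ch u p V N) \<in> PV \<rightarrow>\<^sub>M count_space UNIV" by simp
      then have E: "E h \<in> sets PV" for h
        unfolding E_def by measurable
      let ?H = "{h \<in> H. p (out u h) < \<beta>}"
      have "(\<Prod>i\<in>I. g h i (p i)) = (if p (out u h) < \<beta> then emeasure PV (E h) else 0)"
        if h: "h \<in> H" for h
      proof -
        have sub: "fst ` set h \<subseteq> I" and o: "out u h \<in> I"
          using h by (auto simp: I_def H_def)
        show ?thesis
        proof (cases "p (out u h) < \<beta>")
          case True
          then have "(\<Prod>i\<in>I. g h i (p i))
              = (\<Prod>i\<in>I. ennreal (p i ^ outcomes True i h * (1 - p i) ^ outcomes False i h))"
            by (intro prod.cong) (auto simp: g_def)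
          also have "\<dots> = ennreal (likelihood p h)"
            using p unfolding likelihood_arms[OF finI sub]
            by (intro prod_ennreal mult_nonneg_nonneg zero_le_power) auto
          also have "\<dots> = emeasure PV (E h)"
            unfolding E_def PV_def
            using emeasure_hist_eq[OF p, of h ch u N] h by (simp add: H_def)
          finally show ?thesis using True by simp
        next
          case False
          then have "g h (out u h) (p (out u h)) = 0" by (simp add: g_def)
          then show ?thesis using False o finI by (auto intro!: prod_zero)
        qed
      qed
      then have "(\<Sum>h\<in>H. \<Prod>i\<in>I. g h i (p i))
          = (\<Sum>h\<in>H. if p (out u h) < \<beta> then emeasure PV (E h) else 0)"
        by (rule sum.cong[OF refl])
      also have "\<dots> = (\<Sum>h\<in>?H. emeasure PV (E h))"
        using finH by (intro sum.inter_filter[symmetric])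
      also have "\<dots> = emeasure PV (\<Union>h\<in>?H. E h)"
        using E finH by (intro sum_emeasure) (auto simp: disjoint_family_on_def E_def)
      also have "(\<Union>h\<in>?H. E h) = Pair p -` (Pair u -` B)"
        using hist_in_histories[of ch u p _ N]
        by (auto simp: E_def B_def H_def BS space_pair_measure)
      finally show ?thesis by simp
    qed
    have "AE x in \<mu>. x \<in> {0..1}"
      using m1 by (intro \<mu>.AE_prob_1) auto
    then have "AE p in PP. p i \<in> {0..1}" for i
      unfolding PP_def by (intro AE_PiM_component prob) auto
    then have "AE p in PP. \<forall>i. p i \<in> {0..1}"
      by (simp add: AE_all_countable)
    then have AE_p: "AE p in PP. (\<Sum>h\<in>H. \<Prod>i\<in>I. g h i (p i)) \<le> emeasure PV (Pair p -` (Pair u -` B))"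
      using sum_g by (auto elim!: eventually_mono)
    have arm_ge: "ennreal (w h i * (if i = out u h then \<theta> else 1)) \<le> (\<integral>\<^sup>+x. g h i x \<partial>\<mu>)"
      if h: "h \<in> H" for h i
    proof -
      have kl: "outcomes True i h + outcomes False i h \<le> N"
        using outcomes_sum[of i h] pulls_le_length[of i h] length_histories[of h "ch u" N] h
        by (simp add: H_def)
      let ?f = "\<lambda>x. x ^ outcomes True i h * (1 - x) ^ outcomes False i h
        * indicator (if i = out u h then {..<\<beta>} else UNIV) x :: real"
      have AE01: "AE x in \<mu>. 0 \<le> ?f x \<and> ?f x \<le> 1"
        using \<open>AE x in \<mu>. x \<in> {0..1}\<close>
      proof eventually_elim
        case (elim x)
        then have "x ^ outcomes True i h * (1 - x) ^ outcomes False i h \<le> 1"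
          by (intro mult_le_one power_le_one) auto
        with elim show ?case by (auto simp: indicator_def)
      qed
      have int: "integrable \<mu> ?f"
        using AE01 by (intro \<mu>.integrable_const_bound[where B = 1]) auto
      have "(\<integral>\<^sup>+x. g h i x \<partial>\<mu>) = ennreal (\<integral>x. ?f x \<partial>\<mu>)"
        unfolding g_def using AE01 by (intro nn_integral_eq_integral int) auto
      moreover have "w h i * (if i = out u h then \<theta> else 1) \<le> (\<integral>x. ?f x \<partial>\<mu>)"
        using bad[OF kl] le[OF kl] by (auto simp: w_def mult.commute)
      ultimately show ?thesis by (simp add: ennreal_leI)
    qed
    have nnw: "0 \<le> w h i" if h: "h \<in> H" for h i
      using outcomes_sum[of i h] pulls_le_length[of i h] length_histories[of h "ch u" N] h
      by (simp add: H_def w_def nn)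
    have hist_ge: "ennreal (\<theta> * (\<Prod>i\<in>I. w h i)) \<le> (\<integral>\<^sup>+p. (\<Prod>i\<in>I. g h i (p i)) \<partial>PP)"
      if h: "h \<in> H" for h
    proof -
      have o: "out u h \<in> I" using h by (auto simp: I_def H_def)
      \<comment> \<open>The output arm is exactly one of the factors, so \<open>\<theta>\<close> is
        paid once rather than once per arm.\<close>
      have "\<theta> * (\<Prod>i\<in>I. w h i) = (\<Prod>i\<in>I. w h i * (if i = out u h then \<theta> else 1))"
        using finI o by (simp add: prod.distrib prod.delta)
      also have "ennreal \<dots> = (\<Prod>i\<in>I. ennreal (w h i * (if i = out u h then \<theta> else 1)))"
        using nnw[OF h] \<theta> by (intro prod_ennreal[symmetric]) auto
      also have "\<dots> \<le> (\<Prod>i\<in>I. \<integral>\<^sup>+x. g h i x \<partial>\<mu>)"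
        using arm_ge[OF h] by (intro prod_mono_ennreal) auto
      also have "\<dots> = (\<integral>\<^sup>+p. (\<Prod>i\<in>I. g h i (p i)) \<partial>PP)"
        unfolding PP_def by (rule nn_integral_PiM_prod[symmetric, OF prob finI g_m])
      finally show ?thesis .
    qed
    have "a ^ N \<le> (\<Sum>h\<in>H. \<Prod>i\<in>I. w h i)"
      unfolding H_def w_def
      by (rule sum_histories_ge[where N = N, OF finI _ zero nn step a order.refl])
         (auto simp: I_def)
    then have "\<theta> * a ^ N \<le> (\<Sum>h\<in>H. \<theta> * (\<Prod>i\<in>I. w h i))"
      using \<theta> by (simp add: sum_distrib_left[symmetric] mult_left_mono)
    then have "ennreal (\<theta> * a ^ N) \<le> ennreal (\<Sum>h\<in>H. \<theta> * (\<Prod>i\<in>I. w h i))"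
      by (rule ennreal_leI)
    also have "\<dots> = (\<Sum>h\<in>H. ennreal (\<theta> * (\<Prod>i\<in>I. w h i)))"
      using nnw \<theta> by (intro sum_ennreal[symmetric] mult_nonneg_nonneg prod_nonneg) auto
    also have "\<dots> \<le> (\<Sum>h\<in>H. \<integral>\<^sup>+p. (\<Prod>i\<in>I. g h i (p i)) \<partial>PP)"
      by (intro sum_mono hist_ge)
    also have "\<dots> = (\<integral>\<^sup>+p. (\<Sum>h\<in>H. \<Prod>i\<in>I. g h i (p i)) \<partial>PP)"
      unfolding PP_def by (intro nn_integral_sum[symmetric]) measurable
    also have "\<dots> \<le> (\<integral>\<^sup>+p. emeasure PV (Pair p -` (Pair u -` B)) \<partial>PP)"
      by (rule nn_integral_mono_AE[OF AE_p])
    also have "\<dots> = emeasure (PP \<Otimes>\<^sub>M PV) (Pair u -` B)"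
      by (rule PV.emeasure_pair_measure_alt[symmetric, OF Bu])
    finally show ?thesis .
  qed
  have "ennreal (\<theta> * a ^ N) = (\<integral>\<^sup>+u. ennreal (\<theta> * a ^ N) \<partial>unif01)"
    by (simp add: U.emeasure_space_1[unfolded space_unif01])
  also have "\<dots> \<le> (\<integral>\<^sup>+u. emeasure (PP \<Otimes>\<^sub>M PV) (Pair u -` B) \<partial>unif01)"
    by (intro nn_integral_mono fixed_seed)
  also have "\<dots> = emeasure (unif01 \<Otimes>\<^sub>M (PP \<Otimes>\<^sub>M PV)) B"
    by (rule R.emeasure_pair_measure_alt[symmetric, OF B])
  also have "\<dots> = ennreal (measure (unif01 \<Otimes>\<^sub>M (PP \<Otimes>\<^sub>M PV)) B)"
    by (rule W.emeasure_eq_measure)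
  also have "measure (unif01 \<Otimes>\<^sub>M (PP \<Otimes>\<^sub>M PV)) B = prob_bad \<mu> \<beta> ch out N"
    unfolding prob_bad_def B_def BS ..
  finally show ?thesis
    by (simp add: prob_bad_def)
qed

section \<open>One pull of a tilted arm\<close>

text \<open>The Gibbs variational principle on two points: each trial win probability
  \<open>q\<close> yields a lower bound for the logarithm of a sum, so \<open>q\<close> may be
  chosen to suit the trajectory.\<close>

lemma two_point_Gibbs:
  fixes q x y :: real
  assumes "0 < q" "q < 1" "0 < x" "0 < y"
  shows "q * (ln x - ln q) + (1 - q) * (ln y - ln (1 - q)) \<le> ln (x + y)"
proof -
  let ?z = "x + y"
  have z: "0 < ?z" using assms by simp
  have "q * (ln x - ln q - ln ?z) = q * ln (x / (q * ?z))"
    using assms z by (simp add: ln_div ln_mult)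
  also have "\<dots> \<le> q * (x / (q * ?z) - 1)"
    using assms z by (intro mult_left_mono ln_le_minus_one divide_pos_pos mult_pos_pos) auto
  also have "\<dots> = x / ?z - q"
    using assms by (simp add: right_diff_distrib)
  finally have 1: "q * (ln x - ln q - ln ?z) \<le> x / ?z - q" .
  have "(1 - q) * (ln y - ln (1 - q) - ln ?z) = (1 - q) * ln (y / ((1 - q) * ?z))"
    using assms z by (simp add: ln_div ln_mult)
  also have "\<dots> \<le> (1 - q) * (y / ((1 - q) * ?z) - 1)"
    using assms z by (intro mult_left_mono ln_le_minus_one divide_pos_pos mult_pos_pos) auto
  also have "\<dots> = y / ?z - (1 - q)"
    using assms by (simp add: right_diff_distrib)
  finally have 2: "(1 - q) * (ln y - ln (1 - q) - ln ?z) \<le> y / ?z - (1 - q)" .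
  have "x / ?z + y / ?z = 1"
    using z by (simp add: add_divide_distrib[symmetric])
  then have "q * (ln x - ln q - ln ?z) + (1 - q) * (ln y - ln (1 - q) - ln ?z) \<le> 0"
    using 1 2 by linarith
  then show ?thesis by (simp add: algebra_simps)
qed

section \<open>Logarithm bounds and relative entropy\<close>

lemma ln_one_minus_le: "ln (1 - t) \<le> - t - t\<^sup>2 / 2" if "0 \<le> t" "t < 1" for t :: real
proof -
  let ?f = "\<lambda>t. - t - t\<^sup>2 / 2 - ln (1 - t)"
  have "?f 0 \<le> ?f t"
  proof (rule DERIV_nonneg_imp_nondecreasing[OF that(1)])
    fix u assume u: "0 \<le> u" "u \<le> t"
    then have "u < 1" using that by simp
    then have "(?f has_real_derivative (u\<^sup>2 / (1 - u))) (at u)"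
      by (auto intro!: derivative_eq_intros simp: field_simps power2_eq_square)
    moreover have "0 \<le> u\<^sup>2 / (1 - u)" using \<open>u < 1\<close> by simp
    ultimately show "\<exists>y. (?f has_real_derivative y) (at u) \<and> 0 \<le> y" by blast
  qed
  then show ?thesis by simp
qed

lemma ln_one_plus_le: "ln (1 + t) \<le> t - t\<^sup>2 / 2 + t ^ 3 / 3" if "0 \<le> t" for t :: real
proof -
  let ?f = "\<lambda>t. t - t\<^sup>2 / 2 + t ^ 3 / 3 - ln (1 + t)"
  have "?f 0 \<le> ?f t"
  proof (rule DERIV_nonneg_imp_nondecreasing[OF that])
    fix u assume u: "0 \<le> u" "u \<le> t"
    then have "(?f has_real_derivative (u ^ 3 / (1 + u))) (at u)"
      by (auto intro!: derivative_eq_intros simp: field_simps power2_eq_square power3_eq_cube)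
    moreover have "0 \<le> u ^ 3 / (1 + u)" using u by simp
    ultimately show "\<exists>y. (?f has_real_derivative y) (at u) \<and> 0 \<le> y" by blast
  qed
  then show ?thesis by simp
qed

text \<open>The left side is the relative entropy of mean \<open>p - e\<close> with respect to mean
  \<open>p\<close>. Its quadratic coefficient has to be exact, because it becomes the constant of
  the exponent; the cubic remainder may be crude.\<close>

lemma Bernoulli_KL_le:
  fixes p e m :: real
  assumes m: "0 < m" "m \<le> p" "p \<le> 1 - m" and e: "0 \<le> e" "e < m"
  shows "(p - e) * (ln (p - e) - ln p) + (1 - p + e) * (ln (1 - p + e) - ln (1 - p))
    \<le> e\<^sup>2 / (2 * (p * (1 - p))) + e ^ 3 / m\<^sup>2"
proof -
  have p: "0 < p" "p < 1" "e < p" "e < 1 - p" using assms by auto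
  define s t where "s = e / p" and "t = e / (1 - p)"
  have s: "0 \<le> s" "s < 1" "e = p * s" and t: "0 \<le> t" "t < 1" "e = (1 - p) * t"
    using p e by (auto simp: s_def t_def)
  have "ln (p - e) - ln p = ln (1 - s)"
  proof -
    have "p - e = p * (1 - s)" using s by (simp add: algebra_simps)
    then show ?thesis using p s by (simp add: ln_mult)
  qed
  also have "\<dots> \<le> - s - s\<^sup>2 / 2" using s by (intro ln_one_minus_le)
  finally have "(p - e) * (ln (p - e) - ln p) \<le> (p - e) * (- s - s\<^sup>2 / 2)"
    using p by (intro mult_left_mono) auto
  also have "\<dots> = - e + p * s\<^sup>2 / 2 + p * s ^ 3 / 2"
    unfolding s(3) by (simp add: field_simps power2_eq_square power3_eq_cube)
  finally have 1: "(p - e) * (ln (p - e) - ln p) \<le> - e + p * s\<^sup>2 / 2 + p * s ^ 3 / 2" .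
  have pe: "1 - p + e = (1 - p) * (1 + t)" using t by (simp add: algebra_simps)
  have "ln (1 - p + e) - ln (1 - p) = ln (1 + t)"
    unfolding pe using p t by (simp add: ln_mult)
  also have "\<dots> \<le> t - t\<^sup>2 / 2 + t ^ 3 / 3" using t by (intro ln_one_plus_le)
  finally have "(1 - p + e) * (ln (1 - p + e) - ln (1 - p)) \<le> (1 - p + e) * (t - t\<^sup>2 / 2 + t ^ 3 / 3)"
    using p e by (intro mult_left_mono) auto
  also have "\<dots> = (1 - p) * (1 + t) * (t - t\<^sup>2 / 2 + t ^ 3 / 3)"
    by (simp only: pe)
  also have "\<dots> = e + (1 - p) * t\<^sup>2 / 2 + (1 - p) * t ^ 3 * (- 1 / 6 + t / 3)"
    unfolding t(3) by (simp add: field_simps power2_eq_square power3_eq_cube)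
  also have "\<dots> \<le> e + (1 - p) * t\<^sup>2 / 2 + (1 - p) * t ^ 3 * (1 / 6)"
    using p t by (intro add_left_mono mult_left_mono) auto
  finally have 2: "(1 - p + e) * (ln (1 - p + e) - ln (1 - p))
      \<le> e + (1 - p) * t\<^sup>2 / 2 + (1 - p) * t ^ 3 / 6"
    by simp
  have 3: "p * s\<^sup>2 / 2 + (1 - p) * t\<^sup>2 / 2 = e\<^sup>2 / (2 * (p * (1 - p)))"
  proof -
    have "p * s\<^sup>2 = e\<^sup>2 / p" "(1 - p) * t\<^sup>2 = e\<^sup>2 / (1 - p)"
      using p by (simp_all add: s_def t_def power2_eq_square)
    moreover have "e\<^sup>2 / p + e\<^sup>2 / (1 - p) = e\<^sup>2 / (p * (1 - p))"
      using p by (simp add: add_frac_eq) (simp add: algebra_simps)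
    moreover have "p * s\<^sup>2 / 2 + (1 - p) * t\<^sup>2 / 2 = (p * s\<^sup>2 + (1 - p) * t\<^sup>2) / 2"
      by (rule add_divide_distrib[symmetric])
    ultimately show ?thesis by simp
  qed
  have "p * s ^ 3 = e ^ 3 / p\<^sup>2"
    using p by (simp add: s_def field_simps power2_eq_square power3_eq_cube)
  also have "\<dots> \<le> e ^ 3 / m\<^sup>2"
    using assms by (intro divide_left_mono power_mono mult_pos_pos) auto
  finally have 4: "p * s ^ 3 \<le> e ^ 3 / m\<^sup>2" .
  have "(1 - p) * t ^ 3 = e ^ 3 / (1 - p)\<^sup>2"
    using p by (simp add: t_def power2_eq_square power3_eq_cube)
  also have "\<dots> \<le> e ^ 3 / m\<^sup>2"
    using assms p by (intro divide_left_mono power_mono mult_pos_pos) auto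
  finally have 5: "(1 - p) * t ^ 3 \<le> e ^ 3 / m\<^sup>2" .
  have "0 \<le> e ^ 3 / m\<^sup>2" using e by simp
  then show ?thesis using 1 2 3 4 5 by linarith
qed

text \<open>Two-point Jensen for the outcome of the next pull, taken with win probability
  \<open>q = (s + 1) * f' - s * f\<close>: this is the choice that makes \<open>k - s * f\<close> a martingale.\<close>

lemma tilt_step:
  fixes f f' m \<phi> \<phi>' c R R' \<kappa> :: real and k l :: nat
  defines "s \<equiv> real (k + l)" and "d \<equiv> f - f'"
  assumes m: "0 < m" "m \<le> f'" "f' \<le> f" "f \<le> 1 - m" and small: "s * d < m"
    and \<phi>: "0 \<le> \<phi>'" "\<phi>' \<le> \<phi>" and c: "0 \<le> c" "(d / m)\<^sup>2 \<le> c * (\<phi> - \<phi>')"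
    and \<kappa>: "(s * d)\<^sup>2 / (2 * (f' * (1 - f'))) + (s * d) ^ 3 / m\<^sup>2 + s * d * d / m\<^sup>2 + c + \<phi>'
      + (R' - R) \<le> \<kappa>"
  shows "exp (- \<kappa>) * (f ^ k * (1 - f) ^ l * exp (- R - \<phi> * (k - s * f)\<^sup>2))
    \<le> f' ^ Suc k * (1 - f') ^ l * exp (- R' - \<phi>' * (Suc k - (s + 1) * f')\<^sup>2)
      + f' ^ k * (1 - f') ^ Suc l * exp (- R' - \<phi>' * (k - (s + 1) * f')\<^sup>2)"
proof -
  define e q M where "e = s * d" and "q = f' - e" and "M = k - s * f"
  have s0: "0 \<le> s" and d0: "0 \<le> d" using m by (auto simp: s_def d_def)
  then have e: "0 \<le> e" "e < m" using small by (auto simp: e_def)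
  have f: "0 < f" "f < 1" "0 < f'" "f' < 1" using m by auto
  have q: "0 < q" "q < 1" "q \<le> 1" "1 - q = 1 - f' + e" using e m by (auto simp: q_def)
  \<comment> \<open>The centred count \<open>M\<close> moves by \<open>1 - q\<close> on a win and by
    \<open>- q\<close> on a loss, so under \<open>q\<close> its mean is preserved and its square
    grows by \<open>q * (1 - q)\<close>.\<close>
  have M1: "Suc k - (s + 1) * f' = M + 1 - q" and M0: "k - (s + 1) * f' = M - q"
    by (auto simp: M_def q_def e_def d_def algebra_simps)
  define X Y where "X = f' ^ Suc k * (1 - f') ^ l * exp (- R' - \<phi>' * (M + 1 - q)\<^sup>2)"
    and "Y = f' ^ k * (1 - f') ^ Suc l * exp (- R' - \<phi>' * (M - q)\<^sup>2)"
  have XY: "0 < X" "0 < Y" using f by (auto simp: X_def Y_def)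
  \<comment> \<open>A new level re-scores all past rewards with \<open>f'\<close> in place of
    \<open>f\<close>. The change \<open>k * u + l * v\<close> splits into a drift
    \<open>s * (f * u + (1 - f) * v)\<close> and a fluctuation \<open>M * (u - v)\<close>.\<close>
  define u v where "u = ln f' - ln f" and "v = ln (1 - f') - ln (1 - f)"
  have lnX: "ln X = (k + 1) * ln f' + l * ln (1 - f') - R' - \<phi>' * (M + 1 - q)\<^sup>2"
    using f by (simp add: X_def ln_mult ln_realpow) (simp add: algebra_simps)
  have lnY: "ln Y = k * ln f' + (l + 1) * ln (1 - f') - R' - \<phi>' * (M - q)\<^sup>2"
    using f by (simp add: Y_def ln_mult ln_realpow) (simp add: algebra_simps)
  have expand: "q * (ln X - ln q) + (1 - q) * (ln Y - ln (1 - q))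
    = k * ln f' + l * ln (1 - f')
      - (q * (ln q - ln f') + (1 - q) * (ln (1 - q) - ln (1 - f'))) - R' - \<phi>' * (M\<^sup>2 + q * (1 - q))"
    unfolding lnX lnY by (simp add: algebra_simps power2_eq_square)
  have "q * (ln q - ln f') + (1 - q) * (ln (1 - q) - ln (1 - f'))
      \<le> e\<^sup>2 / (2 * (f' * (1 - f'))) + e ^ 3 / m\<^sup>2"
    unfolding q(4) using Bernoulli_KL_le[of m f' e] m e by (simp add: q_def)
  then have KL: "k * ln f' + l * ln (1 - f') - (e\<^sup>2 / (2 * (f' * (1 - f'))) + e ^ 3 / m\<^sup>2)
      - R' - \<phi>' * (M\<^sup>2 + q * (1 - q)) \<le> q * (ln X - ln q) + (1 - q) * (ln Y - ln (1 - q))"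
    unfolding expand by simp
  have "q * (1 - q) \<le> 1" using q by (intro mult_le_one) auto
  then have var: "\<phi>' * (M\<^sup>2 + q * (1 - q)) \<le> \<phi>' * M\<^sup>2 + \<phi>'"
    using \<phi> mult_left_mono[of "q * (1 - q)" 1 \<phi>'] by (simp add: algebra_simps)
  have u: "- u \<le> d / f'"
    using ln_le_minus_one[of "f / f'"] f by (simp add: u_def d_def ln_div diff_divide_distrib)
  have v1: "v \<le> d / (1 - f)"
  proof -
    have "ln ((1 - f') / (1 - f)) \<le> (1 - f') / (1 - f) - 1"
      using f by (intro ln_le_minus_one divide_pos_pos) auto
    also have "\<dots> = d / (1 - f)" using f by (simp add: d_def field_simps)
    finally show ?thesis using f by (simp add: v_def ln_div)
  qed
  have v2: "d / (1 - f') \<le> v"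
  proof -
    have "ln ((1 - f) / (1 - f')) \<le> (1 - f) / (1 - f') - 1"
      using f by (intro ln_le_minus_one divide_pos_pos) auto
    also have "\<dots> = - (d / (1 - f'))" using f by (simp add: d_def field_simps)
    finally show ?thesis using f by (simp add: v_def ln_div)
  qed
  have "u \<le> 0" "0 \<le> v" using f m by (auto simp: u_def v_def)
  have "d / f' \<le> d / m" "d / (1 - f) \<le> d / m"
    using d0 m f by (auto intro!: divide_left_mono)
  then have uv: "\<bar>u - v\<bar> \<le> 2 * (d / m)"
    using u v1 \<open>u \<le> 0\<close> \<open>0 \<le> v\<close> by linarith
  \<comment> \<open>The fluctuation is linear in \<open>M\<close>; the weakening of the Gaussian
    factor from \<phi> to \<phi>' releases a multiple of \<open>M\<^sup>2\<close> that dominates it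
    up to the constant \<open>c\<close>.\<close>
  have amgm: "\<bar>M\<bar> * (2 * (d / m)) \<le> (\<phi> - \<phi>') * M\<^sup>2 + c"
  proof (rule power2_le_imp_le)
    have "(\<bar>M\<bar> * (2 * (d / m)))\<^sup>2 = 4 * M\<^sup>2 * (d / m)\<^sup>2"
      by (simp add: power_mult_distrib power_divide)
    also have "\<dots> \<le> 4 * M\<^sup>2 * (c * (\<phi> - \<phi>'))"
      using c by (intro mult_left_mono) auto
    also have "\<dots> = 2 * (2 * ((\<phi> - \<phi>') * M\<^sup>2) * c)"
      by (simp add: mult_ac)
    also have "\<dots> \<le> ((\<phi> - \<phi>') * M\<^sup>2 + c)\<^sup>2"
      using sum_squares_bound[of "(\<phi> - \<phi>') * M\<^sup>2" c] unfolding power2_sum by linarith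
    finally show "(\<bar>M\<bar> * (2 * (d / m)))\<^sup>2 \<le> ((\<phi> - \<phi>') * M\<^sup>2 + c)\<^sup>2" .
    show "0 \<le> (\<phi> - \<phi>') * M\<^sup>2 + c" using \<phi> c by simp
  qed
  have "- (M * (u - v)) \<le> \<bar>M\<bar> * \<bar>u - v\<bar>"
    by (metis abs_ge_minus_self abs_mult)
  also have "\<dots> \<le> \<bar>M\<bar> * (2 * (d / m))"
    using uv by (intro mult_left_mono) auto
  finally have M_uv: "- (M * (u - v)) \<le> (\<phi> - \<phi>') * M\<^sup>2 + c"
    using amgm by linarith
  \<comment> \<open>The terms linear in \<open>d\<close> cancel, so the drift is of second order in
    \<open>d\<close> and remains small after multiplication by \<open>s\<close>.\<close>
  have "- (f * u + (1 - f) * v) \<le> f * (d / f') - (1 - f) * (d / (1 - f'))"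
    using u v2 f mult_left_mono[of "- u" "d / f'" f] mult_left_mono[of "d / (1 - f')" v "1 - f"]
    by simp
  also have "\<dots> = d * d / (f' * (1 - f'))"
    using f by (simp add: d_def field_simps)
  also have "\<dots> \<le> d * d / m\<^sup>2"
  proof -
    have "m * m \<le> f' * (1 - f')" using m by (intro mult_mono) auto
    then show ?thesis
      using m f d0 by (intro divide_left_mono mult_pos_pos) (auto simp: power2_eq_square)
  qed
  finally have "s * - (f * u + (1 - f) * v) \<le> s * (d * d / m\<^sup>2)"
    using s0 by (intro mult_left_mono)
  then have "- (s * (f * u + (1 - f) * v)) \<le> s * (d * d / m\<^sup>2)"
    by (simp only: mult_minus_right)
  moreover have "k * u + l * v = s * (f * u + (1 - f) * v) + M * (u - v)"
    by (simp add: M_def s_def algebra_simps)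
  ultimately have drift: "- (s * (d * d / m\<^sup>2)) - ((\<phi> - \<phi>') * M\<^sup>2 + c) \<le> k * u + l * v"
    using M_uv by linarith
  let ?\<Lambda> = "f ^ k * (1 - f) ^ l * exp (- R - \<phi> * M\<^sup>2)"
  have "ln (exp (- \<kappa>) * ?\<Lambda>) = - \<kappa> + k * ln f + l * ln (1 - f) - R - \<phi> * M\<^sup>2"
    using f by (simp add: ln_mult ln_realpow)
  also have "\<dots> \<le> q * (ln X - ln q) + (1 - q) * (ln Y - ln (1 - q))"
    using KL var drift \<kappa> by (simp add: u_def v_def e_def[symmetric] algebra_simps) (simp add: e_def algebra_simps)
  also have "\<dots> \<le> ln (X + Y)"
    using q XY by (intro two_point_Gibbs)
  finally have "exp (- \<kappa>) * ?\<Lambda> \<le> X + Y"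
    using XY f by (subst (asm) ln_le_cancel_iff) auto
  then show ?thesis
    by (simp only: X_def Y_def M1 M0 M_def)
qed

section \<open>The slowly decaying trajectory\<close>

text \<open>This is sin^2(t / 2), the inverse of p -> arccos(1 - 2p). On [0, pi] its derivative (sin
  t) / 2 equals the standard deviation of the Bernoulli law with this mean, which is why Fisher
  information in \<open>t\<close> is one.\<close>

definition bern_mean :: "real \<Rightarrow> real" where
  "bern_mean t = (1 - cos t) / 2"

lemma bern_mean_mono: "0 \<le> s \<Longrightarrow> s \<le> t \<Longrightarrow> t \<le> pi \<Longrightarrow> bern_mean s \<le> bern_mean t"
  by (simp add: bern_mean_def cos_monotone_0_pi_le)

lemma bern_mean_variance: "bern_mean t * (1 - bern_mean t) = (sin t / 2)\<^sup>2"
  by (simp add: bern_mean_def power_divide sin_squared_eq) (simp add: field_simps power2_eq_square)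

text \<open>The sine is taken at the lower end point because relative entropy is measured against
  the lower mean, whose variance contains the same sine; the extra \<open>t - s\<close> pays for
  this shift.\<close>

lemma bern_mean_diff_le:
  assumes "s \<le> t"
  shows "bern_mean t - bern_mean s \<le> (t - s) * (sin s + (t - s)) / 2"
proof (cases "s = t")
  case False
  have "\<exists>z>s. z < t \<and> bern_mean t - bern_mean s = (t - s) * (sin z / 2)"
    using False assms unfolding bern_mean_def
    by (intro MVT2) (auto intro!: derivative_eq_intros)
  then obtain z where z: "s < z" "z < t" "bern_mean t - bern_mean s = (t - s) * (sin z / 2)"
    by blast
  have "sin z - sin s \<le> z - s"
  proof -
    have "\<exists>w>s. w < z \<and> sin z - sin s = (z - s) * cos w"
      using z by (intro MVT2) (auto intro!: derivative_eq_intros)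
    then obtain w where "sin z - sin s = (z - s) * cos w" by blast
    also have "\<dots> \<le> (z - s) * 1" using z by (intro mult_left_mono) auto
    finally show ?thesis by simp
  qed
  then have "(t - s) * (sin z / 2) \<le> (t - s) * ((sin s + (t - s)) / 2)"
    using z by (intro mult_left_mono) auto
  then show ?thesis using z by simp
qed simp

text \<open>Everything here is non-asymptotic; \<open>b\<close>, \<open>A\<close>,
  \<open>\<rho>\<close> and \<open>s0\<close> are tied to \<open>N\<close> only at the end. The
  margin \<open>m\<close> keeps the means away from 0 and 1, and \<open>b < m\<close> keeps the
  tilted win probability of the next pull positive.\<close>

locale tilting =
  fixes \<theta>1 \<theta>2 b A \<rho> m :: real and s0 :: nat
  assumes \<theta>: "0 < \<theta>1" "\<theta>1 < \<theta>2" "\<theta>2 < pi"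
    and b: "0 < b" "b < m" and A: "0 < A" and \<rho>: "0 \<le> \<rho>"
    and m: "m \<le> bern_mean \<theta>1" "bern_mean \<theta>2 \<le> 1 - m" and s0: "0 < s0"
begin

text \<open>The parameter \<^term>\<open>angle s\<close> moves at constant speed in \<^term>\<open>ln s\<close>: if the mean reward
  of the first \<open>s\<close> pulls is \<open>level s\<close>, then the \<open>s\<close>-th pull itself sits \<open>b\<close> lower on the
  angle scale, so every pull costs \<open>b\<^sup>2 / 2\<close> no matter when the arm is abandoned.\<close>

definition angle :: "nat \<Rightarrow> real" where
  "angle s = max \<theta>1 (\<theta>2 - b * ln (max 1 (s / s0)))"

definition level :: "nat \<Rightarrow> real" where
  "level s = bern_mean (angle s)"

text \<open>For \<open>k\<close> wins and \<open>l\<close> losses. The factor with \<open>\<rho>\<close> prepays, spread over the first \<open>s0\<close>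
  pulls, the price of replacing an arm of mean \<open>x\<close> by one of mean \<^term>\<open>level s\<close>. The Gaussian
  factor absorbs the correlation between the fluctuation of the rewards and the algorithm's
  decision to keep pulling the arm.\<close>

definition tilt :: "real \<Rightarrow> nat \<Rightarrow> nat \<Rightarrow> real" where
  "tilt x k l = (let s = k + l; f = min x (level s) in
    f ^ k * (1 - f) ^ l * exp (- \<rho> * min s s0 - A / max s s0 * (k - s * f)\<^sup>2))"

text \<open>In order: the quadratic and cubic parts of the relative entropy of the tilted pull, the
  drift and the fluctuation of the re-scored past, the growth of the variance inside the Gaussian
  factor, and the prepayment.\<close>

definition cost :: real where
  "cost = b\<^sup>2 / 2 * (1 + b / m)\<^sup>2 + b ^ 3 / m\<^sup>2 + b\<^sup>2 / (s0 * m\<^sup>2) + 2 * b\<^sup>2 / (A * m\<^sup>2) + A / s0 + \<rho>"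

lemma m_bounds: "0 < m" "m < 1"
  using b m bern_mean_mono[of \<theta>1 \<theta>2] \<theta> by linarith+

lemma angle_bounds: "\<theta>1 \<le> angle s" "angle s \<le> \<theta>2"
  using \<theta> b by (auto simp: angle_def)

lemma level_bounds: "bern_mean \<theta>1 \<le> level s" "level s \<le> bern_mean \<theta>2"
  using angle_bounds[of s] \<theta> unfolding level_def by (auto intro!: bern_mean_mono)

lemma level_early: "s \<le> s0 \<Longrightarrow> level s = bern_mean \<theta>2"
  using \<theta> s0 by (simp add: level_def angle_def)

lemma level_late:
  assumes "s0 * exp ((\<theta>2 - \<theta>1) / b) \<le> s"
  shows "level s = bern_mean \<theta>1"
proof -
  have "exp ((\<theta>2 - \<theta>1) / b) \<le> s / s0"
    using assms s0 by (simp add: field_simps)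
  also have "\<dots> \<le> max 1 (s / s0)" by simp
  finally have "(\<theta>2 - \<theta>1) / b \<le> ln (max 1 (s / s0))"
    by (subst ln_ge_iff) auto
  then have "\<theta>2 - \<theta>1 \<le> b * ln (max 1 (s / s0))"
    using b by (simp add: field_simps)
  then have "angle s = \<theta>1" by (simp add: angle_def)
  then show ?thesis by (simp add: level_def)
qed

lemma angle_step:
  assumes "s0 \<le> s"
  shows "angle (Suc s) \<le> angle s" "angle s - angle (Suc s) \<le> b / s"
proof -
  have s: "0 < s" using assms s0 by simp
  have mx: "max 1 (s / s0) = s / s0" "max 1 (Suc s / s0) = Suc s / s0"
    using assms s0 by (auto simp: max_def field_simps)
  have "1 + 1 / real s = Suc s / s" using s by (simp add: field_simps)
  then have "ln (Suc s / s0) - ln (s / s0) = ln (1 + 1 / s)"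
    using s s0 by (simp add: ln_div)
  also have "\<dots> \<le> 1 / s" by (intro ln_add_one_self_le_self) simp
  finally have 1: "ln (Suc s / s0) - ln (s / s0) \<le> 1 / s" .
  have 2: "ln (s / s0) \<le> ln (Suc s / s0)"
    using s s0 by (simp add: divide_right_mono)
  have "b * ln (Suc s / s0) - b * ln (s / s0) \<le> b * (1 / s)"
    using mult_left_mono[OF 1, of b] b by (simp add: right_diff_distrib)
  moreover have "b * ln (s / s0) \<le> b * ln (Suc s / s0)"
    using mult_left_mono[OF 2, of b] b by simp
  moreover have "0 \<le> b * (1 / s)" using b by simp
  ultimately show "angle (Suc s) \<le> angle s" "angle s - angle (Suc s) \<le> b / s"
    unfolding angle_def mx by auto
qed

text \<open>An arm whose mean \<open>x\<close> is at most the new level does not move. Otherwise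
  \<open>s * d\<close> is at most about \<open>b\<close> times half the sine of the new angle, and
  the variance is the square of that half sine; the sines cancel and \<open>b\<^sup>2 / 2\<close>
  remains.\<close>

lemma level_step:
  assumes s: "s0 \<le> s" and x: "bern_mean \<theta>1 \<le> x"
  defines "f' \<equiv> min x (level (Suc s))"
  defines "d \<equiv> min x (level s) - f'"
  shows "0 \<le> d" "s * d \<le> b" "(s * d)\<^sup>2 / (2 * (f' * (1 - f'))) \<le> b\<^sup>2 / 2 * (1 + b / m)\<^sup>2"
proof -
  let ?t = "angle s" and ?t' = "angle (Suc s)"
  have s_pos: "0 < s" using s s0 by simp
  have t': "0 \<le> ?t'" "?t \<le> pi" using angle_bounds[of s] angle_bounds[of "Suc s"] \<theta> by auto
  have mono: "level (Suc s) \<le> level s"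
    unfolding level_def using angle_step[OF s] t' by (intro bern_mean_mono) auto
  then show d: "0 \<le> d" by (auto simp: d_def f'_def)
  have "s * d \<le> b \<and> (s * d)\<^sup>2 / (2 * (f' * (1 - f'))) \<le> b\<^sup>2 / 2 * (1 + b / m)\<^sup>2"
  proof (cases "x \<le> level (Suc s)")
    case True
    then have "d = 0" using mono by (simp add: d_def f'_def)
    then show ?thesis using b by simp
  next
    case False
    then have f': "f' = bern_mean ?t'" and "d \<le> bern_mean ?t - bern_mean ?t'"
      by (auto simp: d_def f'_def level_def)
    note \<open>d \<le> bern_mean ?t - bern_mean ?t'\<close>
    also have "\<dots> \<le> (?t - ?t') * (sin ?t' + (?t - ?t')) / 2"
      using angle_step[OF s] by (intro bern_mean_diff_le)
    also have "\<dots> \<le> (b / s) * (sin ?t' + b) / 2"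
    proof -
      have "b / s \<le> b" using b s_pos by (simp add: field_simps)
      moreover have "0 \<le> sin ?t'" using t' angle_step(1)[OF s] by (intro sin_ge_zero) auto
      ultimately show ?thesis
        using angle_step[OF s] b by (intro divide_right_mono mult_mono) auto
    qed
    finally have sd: "s * d \<le> b * (sin ?t' + b) / 2"
      using s_pos by (simp add: field_simps)
    \<comment> \<open>The margin bounds the variance below, hence the sine, and so turns the
      relative error \<open>b / sin ?t'\<close> into \<open>b / m\<close>.\<close>
    have "m \<le> f'" "m \<le> 1 - f'"
      using m level_bounds[of "Suc s"] by (auto simp: f' level_def)
    then have "m * m \<le> f' * (1 - f')"
      using m_bounds by (intro mult_mono) auto
    also have "\<dots> = (sin ?t' / 2)\<^sup>2"
      unfolding f' by (rule bern_mean_variance)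
    also have "\<dots> \<le> (sin ?t')\<^sup>2" by (simp add: power_divide)
    finally have "m\<^sup>2 \<le> (sin ?t')\<^sup>2" by (simp add: power2_eq_square)
    moreover have "0 \<le> sin ?t'" using t' angle_step(1)[OF s] by (intro sin_ge_zero) auto
    ultimately have sin: "m \<le> sin ?t'" by (rule power2_le_imp_le)
    have "b * (sin ?t' + b) / 2 \<le> b * (1 + 1) / 2"
      using b m_bounds by (intro divide_right_mono mult_left_mono add_mono) auto
    then have "s * d \<le> b" using sd by simp
    have "(s * d)\<^sup>2 \<le> (b * (sin ?t' + b) / 2)\<^sup>2"
      using sd d by (intro power_mono) auto
    then have "(s * d)\<^sup>2 / (2 * (f' * (1 - f')))
        \<le> (b * (sin ?t' + b) / 2)\<^sup>2 / (2 * (sin ?t' / 2)\<^sup>2)"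
      unfolding f' bern_mean_variance by (intro divide_right_mono) auto
    also have "\<dots> = b\<^sup>2 / 2 * ((sin ?t' + b) / sin ?t')\<^sup>2"
      by (simp add: power_divide power_mult_distrib)
    also have "\<dots> = b\<^sup>2 / 2 * (1 + b / sin ?t')\<^sup>2"
      using sin m_bounds by (simp add: add_divide_distrib)
    also have "\<dots> \<le> b\<^sup>2 / 2 * (1 + b / m)\<^sup>2"
      using sin m_bounds b
      by (intro mult_left_mono power_mono add_left_mono divide_left_mono) auto
    finally show ?thesis using \<open>s * d \<le> b\<close> by simp
  qed
  then show "s * d \<le> b" "(s * d)\<^sup>2 / (2 * (f' * (1 - f'))) \<le> b\<^sup>2 / 2 * (1 + b / m)\<^sup>2" by auto
qed

lemma cost_terms_nonneg: "0 \<le> b\<^sup>2 / 2 * (1 + b / m)\<^sup>2" "0 \<le> b ^ 3 / m\<^sup>2" "0 \<le> b\<^sup>2 / (s0 * m\<^sup>2)"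
    "0 \<le> 2 * b\<^sup>2 / (A * m\<^sup>2)" "0 \<le> A / s0"
  using A b s0 m_bounds by auto

lemma tilt_submartingale:
  assumes x: "bern_mean \<theta>1 \<le> x"
  shows "exp (- cost) * tilt x k l \<le> tilt x (Suc k) l + tilt x k (Suc l)"
proof -
  let ?s = "k + l"
  let ?f = "min x (level ?s)" and ?f' = "min x (level (Suc ?s))"
  let ?\<phi> = "A / real (max ?s s0)" and ?\<phi>' = "A / real (max (Suc ?s) s0)"
  let ?R = "\<rho> * real (min ?s s0)" and ?R' = "\<rho> * real (min (Suc ?s) s0)"
  let ?d = "?f - ?f'"
  have f: "m \<le> ?f'" "?f \<le> 1 - m"
    using x m level_bounds[of "Suc ?s"] level_bounds[of ?s] by auto
  have \<phi>: "0 \<le> ?\<phi>'" "?\<phi>' \<le> ?\<phi>" "?\<phi>' \<le> A / s0"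
    using A s0 by (auto intro!: divide_left_mono)
  obtain c where c: "0 \<le> ?d" "?s * ?d < m" "0 \<le> c" "(?d / m)\<^sup>2 \<le> c * (?\<phi> - ?\<phi>')"
    "(?s * ?d)\<^sup>2 / (2 * (?f' * (1 - ?f'))) + (?s * ?d) ^ 3 / m\<^sup>2 + ?s * ?d * ?d / m\<^sup>2
      + c + ?\<phi>' + (?R' - ?R) \<le> cost"
  proof (cases "?s < s0")
    case True
    \<comment> \<open>The level is still constant at \<open>s0\<close> itself, so the last pull of
      the initial phase is free of any shift as well.\<close>
    then have d: "?d = 0" using level_early[of ?s] level_early[of "Suc ?s"] by simp
    have R: "?R' - ?R \<le> \<rho>" using True \<rho> by (simp add: algebra_simps)
    show ?thesis
    proof (rule that[of 0])
      show "(?s * ?d)\<^sup>2 / (2 * (?f' * (1 - ?f'))) + (?s * ?d) ^ 3 / m\<^sup>2 + ?s * ?d * ?d / m\<^sup>2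
        + 0 + ?\<phi>' + (?R' - ?R) \<le> cost"
        using cost_terms_nonneg \<phi>(3) R unfolding d cost_def
        by (simp only: mult_zero_right mult_zero_left zero_power2 power_zero_numeral div_0 add_0_left
            add_0_right)
    qed (unfold d, use m_bounds in simp_all)
  next
    case False
    then have s: "s0 \<le> ?s" by simp
    then have s_pos: "0 < ?s" using s0 by linarith
    note ls = level_step[OF s x]
    \<comment> \<open>Solves \<open>(?d / m)\<^sup>2 \<le> ?c * (?\<phi> - ?\<phi>')\<close> using
      \<open>?d \<le> b / ?s\<close> and a difference of coefficients equal to A / (s (s + 1)); the
      2 comes from s + 1 being at most 2s.\<close>
    let ?c = "2 * b\<^sup>2 / (A * m\<^sup>2)"
    have "y \<le> b / real n" if "real n * y \<le> b" "0 < n" for y n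
      using that by (simp add: field_simps)
    then have d_le: "?d \<le> b / ?s" using ls(2) s_pos .
    have d2: "(?d)\<^sup>2 \<le> (b / ?s)\<^sup>2" using ls(1) d_le by (intro power_mono)
    have \<phi>_diff: "?\<phi> - ?\<phi>' = A / (real ?s * (real ?s + 1))"
    proof -
      have "max ?s s0 = ?s" "max (Suc ?s) s0 = Suc ?s" using s by auto
      moreover have "A / real n - A / real (Suc n) = A / (real n * (real n + 1))" if "0 < n" for n
        using that by (simp add: field_simps)
      ultimately show ?thesis using s_pos by (simp only:)
    qed
    have "(?d / m)\<^sup>2 \<le> (b / ?s)\<^sup>2 / m\<^sup>2"
      unfolding power_divide[of ?d m] using d2 by (rule divide_right_mono) simp
    also have "\<dots> = b\<^sup>2 / (m\<^sup>2 * (real ?s)\<^sup>2)"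
      by (simp add: power_divide mult.commute)
    also have "\<dots> \<le> 2 * b\<^sup>2 / (m\<^sup>2 * (real ?s * (real ?s + 1)))"
    proof -
      have "b\<^sup>2 / (m\<^sup>2 * (real n)\<^sup>2) \<le> 2 * b\<^sup>2 / (m\<^sup>2 * (real n * (real n + 1)))" if "0 < n" for n
      proof -
        have "real n * (real n + 1) \<le> 2 * (real n)\<^sup>2"
          using that by (simp add: power2_eq_square)
        then have "2 * b\<^sup>2 / (m\<^sup>2 * (2 * (real n)\<^sup>2)) \<le> 2 * b\<^sup>2 / (m\<^sup>2 * (real n * (real n + 1)))"
          using that m_bounds by (intro divide_left_mono mult_left_mono mult_pos_pos) auto
        then show ?thesis by simp
      qed
      then show ?thesis using s_pos .
    qed
    also have "\<dots> = ?c * (?\<phi> - ?\<phi>')"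
      unfolding \<phi>_diff using A by simp
    finally have c: "(?d / m)\<^sup>2 \<le> ?c * (?\<phi> - ?\<phi>')" .
    have sd: "0 \<le> ?s * ?d" using ls(1) by (intro mult_nonneg_nonneg) auto
    have 1: "(?s * ?d) ^ 3 / m\<^sup>2 \<le> b ^ 3 / m\<^sup>2"
      using ls(2) sd by (intro divide_right_mono power_mono) auto
    have 2: "?s * ?d * ?d / m\<^sup>2 \<le> b\<^sup>2 / (s0 * m\<^sup>2)"
    proof -
      have "?s * ?d * ?d \<le> b * (b / ?s)"
        using ls(1,2) d_le b by (intro mult_mono) auto
      also have "\<dots> \<le> b * (b / s0)"
        using s s0 b by (intro mult_left_mono divide_left_mono) auto
      finally have "?s * ?d * ?d / m\<^sup>2 \<le> b * (b / s0) / m\<^sup>2"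
        by (intro divide_right_mono) auto
      then show ?thesis by (simp add: power2_eq_square)
    qed
    have 3: "?R' - ?R \<le> \<rho>" using s \<rho> by simp
    show ?thesis
    proof (rule that[of ?c])
      show "(?s * ?d)\<^sup>2 / (2 * (?f' * (1 - ?f'))) + (?s * ?d) ^ 3 / m\<^sup>2 + ?s * ?d * ?d / m\<^sup>2
        + ?c + ?\<phi>' + (?R' - ?R) \<le> cost"
        using ls(3) 1 2 3 \<phi>(3) unfolding cost_def by linarith
    qed (use ls(1,2) b c cost_terms_nonneg(4) in linarith)+
  qed
  have "exp (- cost) * (?f ^ k * (1 - ?f) ^ l * exp (- ?R - ?\<phi> * (k - real ?s * ?f)\<^sup>2))
    \<le> ?f' ^ Suc k * (1 - ?f') ^ l * exp (- ?R' - ?\<phi>' * (Suc k - (real ?s + 1) * ?f')\<^sup>2)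
      + ?f' ^ k * (1 - ?f') ^ Suc l * exp (- ?R' - ?\<phi>' * (k - (real ?s + 1) * ?f')\<^sup>2)"
    by (rule tilt_step[OF m_bounds(1) f(1) c(1)[unfolded diff_ge_0_iff_ge] f(2) c(2) \<phi>(1,2) c(3,4,5)])
  moreover have "real (Suc ?s) = real ?s + 1" by simp
  ultimately show ?thesis
    by (simp only: tilt_def Let_def add_Suc add_Suc_right mult_minus_left)
qed

lemma tilt_0: "tilt x 0 0 = 1"
  by (simp add: tilt_def)

lemma tilt_level_bounds:
  assumes "bern_mean \<theta>1 \<le> x" and "f = min x (level s)"
  shows "0 \<le> f" "f \<le> 1"
proof -
  have "bern_mean \<theta>1 \<le> f" "f \<le> bern_mean \<theta>2"
    using assms level_bounds[of s] by auto
  then show "0 \<le> f" "f \<le> 1" using m m_bounds by linarith+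
qed

lemma tilt_nonneg:
  assumes "bern_mean \<theta>1 \<le> x"
  shows "0 \<le> tilt x k l"
  unfolding tilt_def Let_def
  using tilt_level_bounds[OF assms refl, of "k + l"]
  by (intro mult_nonneg_nonneg zero_le_power) auto

lemma tilt_le:
  assumes "bern_mean \<theta>1 \<le> x" and f: "f = min x (level (k + l))"
  shows "tilt x k l \<le> f ^ k * (1 - f) ^ l * exp (- \<rho> * min (k + l) s0)"
proof -
  have "0 \<le> f ^ k * (1 - f) ^ l"
    using tilt_level_bounds[OF assms] by (intro mult_nonneg_nonneg zero_le_power) auto
  moreover have "0 \<le> A / max (k + l) s0 * (k - real (k + l) * f)\<^sup>2"
    using A by (intro mult_nonneg_nonneg) auto
  ultimately show ?thesis
    unfolding tilt_def Let_def f[symmetric] by (intro mult_left_mono) auto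
qed

lemma tilt_le_1:
  assumes "bern_mean \<theta>1 \<le> x"
  shows "tilt x k l \<le> 1"
proof -
  define f where "f = min x (level (k + l))"
  have f: "0 \<le> f" "f \<le> 1" using tilt_level_bounds[OF assms f_def] by auto
  have "tilt x k l \<le> f ^ k * (1 - f) ^ l * exp (- \<rho> * min (k + l) s0)"
    by (rule tilt_le[OF assms f_def])
  also have "\<dots> \<le> 1"
    using f \<rho> by (intro mult_le_one power_le_one mult_nonneg_nonneg zero_le_power) auto
  finally show ?thesis .
qed

lemma tilt_measurable [measurable]: "(\<lambda>x. tilt x k l) \<in> borel_measurable borel"
  unfolding tilt_def Let_def by measurable

end

section \<open>The reservoir\<close>

text \<open>Uniform on \<open>[a, b]\<close> with mass \<open>1 - \<eta>\<close>, plus an atom of mass \<open>\<eta>\<close> at \<open>b\<close>.\<close>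

definition uniform_with_atom :: "real \<Rightarrow> real \<Rightarrow> real \<Rightarrow> real measure" where
  "uniform_with_atom a b \<eta> = distr unif01 borel (\<lambda>v. min b (a + (b - a) / (1 - \<eta>) * v))"

lemma AE_unif01: "AE v in unif01. 0 \<le> v \<and> v \<le> 1"
  unfolding unif01_def by (rule AE_uniform_measureI) auto

lemma measure_unif01: "0 \<le> a \<Longrightarrow> a \<le> b \<Longrightarrow> b \<le> 1 \<Longrightarrow> measure unif01 {a..b} = b - a"
  by (simp add: unif01_def measure_uniform_measure)

context
  fixes a b \<eta> :: real
  assumes ab: "0 \<le> a" "a < b" "b \<le> 1" and \<eta>: "0 < \<eta>" "\<eta> < 1"
begin

private abbreviation "K \<equiv> (b - a) / (1 - \<eta>)"
private abbreviation "\<mu> \<equiv> uniform_with_atom a b \<eta>"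

private lemma K_pos: "0 < K"
  using ab \<eta> by simp

private lemma K_top: "K * v \<le> b - a \<longleftrightarrow> v \<le> 1 - \<eta>" "b - a \<le> K * v \<longleftrightarrow> 1 - \<eta> \<le> v"
proof -
  have "K * (1 - \<eta>) = b - a" using \<eta> by simp
  then show "K * v \<le> b - a \<longleftrightarrow> v \<le> 1 - \<eta>" "b - a \<le> K * v \<longleftrightarrow> 1 - \<eta> \<le> v"
    by (metis K_pos mult_le_cancel_left_pos)+
qed

lemma sets_uniform_with_atom [simp, measurable_cong]: "sets \<mu> = sets borel"
  by (simp add: uniform_with_atom_def)

lemma measure_uniform_with_atom:
  "S \<in> sets borel \<Longrightarrow> measure \<mu> S = measure unif01 {v. min b (a + K * v) \<in> S}"
  unfolding uniform_with_atom_def by (subst measure_distr) (auto simp: vimage_def)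

lemma prob_space_uniform_with_atom: "prob_space \<mu>"
  unfolding uniform_with_atom_def
  by (intro prob_space.prob_space_distr prob_space_unif01) auto

lemma AE_uniform_with_atom: "AE x in \<mu>. a \<le> x \<and> x \<le> b"
  unfolding uniform_with_atom_def
proof (subst AE_distr_iff)
  show "AE v in unif01. a \<le> min b (a + K * v) \<and> min b (a + K * v) \<le> b"
    using AE_unif01
  proof eventually_elim
    case (elim v)
    then have "0 \<le> K * v" using K_pos by (intro mult_nonneg_nonneg) auto
    then show ?case using ab by auto
  qed
qed auto

lemma reservoir_uniform_with_atom: "reservoir \<mu>"
proof -
  interpret prob_space \<mu> by (rule prob_space_uniform_with_atom)
  have "AE x in \<mu>. x \<in> {0..1}"
    using AE_uniform_with_atom by eventually_elim (use ab in auto)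
  then have "measure \<mu> {0..1} = 1"
    by (subst prob_eq_1) auto
  then show ?thesis
    by (simp add: reservoir_def prob_space_axioms)
qed

lemma Ginv_uniform_with_atom: "Ginv \<mu> (1 - \<eta>) = b"
proof -
  interpret prob_space \<mu> by (rule prob_space_uniform_with_atom)
  interpret U: prob_space unif01 by (rule prob_space_unif01)
  have "G \<mu> \<tau> \<ge> 1 - \<eta> \<longleftrightarrow> b \<le> \<tau>" for \<tau>
  proof
    assume "b \<le> \<tau>"
    have "AE x in \<mu>. x \<in> {0..\<tau>}"
      using AE_uniform_with_atom by eventually_elim (use ab \<open>b \<le> \<tau>\<close> in auto)
    then have "G \<mu> \<tau> = 1"
      unfolding G_def by (subst prob_eq_1) auto
    then show "G \<mu> \<tau> \<ge> 1 - \<eta>" using \<eta> by simp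
  next
    assume G: "G \<mu> \<tau> \<ge> 1 - \<eta>"
    show "b \<le> \<tau>"
    proof (rule ccontr)
      assume "\<not> b \<le> \<tau>"
      then have \<tau>: "\<tau> < b" by simp
      \<comment> \<open>The part of [0, 1] that the quantile map can send to at most \<tau>; the
        maximum with 0 treats \<tau> below the support.\<close>
      define c where "c = max 0 ((\<tau> - a) / K)"
      have c: "0 \<le> c" "c < 1 - \<eta>" "c \<le> 1"
      proof -
        have "(\<tau> - a) / K < 1 - \<eta>"
          using \<tau> \<eta> by (subst pos_divide_less_eq[OF K_pos]) simp
        then show "0 \<le> c" "c < 1 - \<eta>" "c \<le> 1" using \<eta> by (auto simp: c_def)
      qed
      have "G \<mu> \<tau> = measure unif01 {v. min b (a + K * v) \<in> {0..\<tau>}}"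
        unfolding G_def by (rule measure_uniform_with_atom) auto
      also have "\<dots> \<le> measure unif01 {0..c}"
      proof (rule U.finite_measure_mono_AE)
        show "AE v in unif01. v \<in> {v. min b (a + K * v) \<in> {0..\<tau>}} \<longrightarrow> v \<in> {0..c}"
          using AE_unif01
        proof eventually_elim
          case (elim v)
          have v: "v \<le> (\<tau> - a) / K" if "a + K * v \<le> \<tau>"
          proof -
            have "K * v \<le> \<tau> - a" using that by linarith
            then show ?thesis by (simp only: pos_le_divide_eq[OF K_pos] mult.commute[of v])
          qed
          show ?case
          proof
            assume "v \<in> {v. min b (a + K * v) \<in> {0..\<tau>}}"
            then have "a + K * v \<le> \<tau>" using \<tau> unfolding mem_Collect_eq atLeastAtMost_iff by linarith
            then show "v \<in> {0..c}" using v elim unfolding c_def by simp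
          qed
        qed
      qed auto
      also have "\<dots> = c" using c by (subst measure_unif01) auto
      finally show False using G c by simp
    qed
  qed
  then have "{\<tau>. G \<mu> \<tau> \<ge> 1 - \<eta>} = {b..}" by auto
  then show ?thesis by (simp add: Ginv_def)
qed

text \<open>Windows to the right of \<open>y\<close> carry mass of order \<delta> even at
  \<open>y = b\<close>, where the uniform part has nothing left: there the atom supplies it.\<close>

lemma uniform_with_atom_window:
  assumes y: "a \<le> y" "y \<le> b" and \<delta>: "0 < \<delta>" "\<delta> \<le> 1"
  shows "min (1 / K) \<eta> * \<delta> \<le> measure \<mu> {y..y + \<delta>}"
proof -
  interpret U: prob_space unif01 by (rule prob_space_unif01)
  have meas: "{v. min b (a + K * v) \<in> {y..y + \<delta>}} \<in> sets unif01" by simp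
  have m: "measure \<mu> {y..y + \<delta>} = measure unif01 {v. min b (a + K * v) \<in> {y..y + \<delta>}}"
    by (rule measure_uniform_with_atom) auto
  show ?thesis
  proof (cases "b \<le> y + \<delta>")
    case True
    have "min (1 / K) \<eta> * \<delta> \<le> \<eta> * 1"
      using \<delta> \<eta> by (intro mult_mono) auto
    also have "\<dots> = measure unif01 {1 - \<eta>..1}"
      using \<eta> by (subst measure_unif01) auto
    also have "\<dots> \<le> measure unif01 {v. min b (a + K * v) \<in> {y..y + \<delta>}}"
    proof (rule U.finite_measure_mono[OF _ meas])
      have b: "min b (a + K * v) = b" if "1 - \<eta> \<le> v" for v
        using that K_top(2)[of v] by linarith
      show "{1 - \<eta>..1} \<subseteq> {v. min b (a + K * v) \<in> {y..y + \<delta>}}"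
      proof
        fix v assume "v \<in> {1 - \<eta>..1}"
        then have v: "min b (a + K * v) = b" using b by simp
        show "v \<in> {v. min b (a + K * v) \<in> {y..y + \<delta>}}"
          unfolding mem_Collect_eq v using True y by simp
      qed
    qed
    finally show ?thesis using m by simp
  next
    case False
    define c d where "c = (y - a) / K" and "d = (y + \<delta> - a) / K"
    have Kcd: "K * c = y - a" "K * d = y + \<delta> - a"
      using ab \<eta> by (simp_all add: c_def d_def)
    have c: "0 \<le> c" unfolding c_def using y K_pos by (intro divide_nonneg_pos) auto
    have cd: "c \<le> d" unfolding c_def d_def using \<delta> K_pos by (intro divide_right_mono) auto
    have "d \<le> 1 - \<eta>" using False Kcd K_top(1)[of d] by linarith
    then have d: "d \<le> 1" using \<eta> by simp
    have "min (1 / K) \<eta> * \<delta> \<le> (1 / K) * \<delta>"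
      using \<delta> by (intro mult_right_mono) auto
    also have "\<dots> = (y + \<delta> - a - (y - a)) / K" by simp
    also have "\<dots> = d - c" unfolding c_def d_def by (rule diff_divide_distrib)
    also have "\<dots> = measure unif01 {c..d}"
      using c cd d by (subst measure_unif01) auto
    also have "\<dots> \<le> measure unif01 {v. min b (a + K * v) \<in> {y..y + \<delta>}}"
    proof (rule U.finite_measure_mono[OF _ meas], safe)
      fix v assume "v \<in> {c..d}"
      then have "c \<le> v" "v \<le> d" by auto
      then have "K * c \<le> K * v" "K * v \<le> K * d"
        by (auto intro!: mult_left_mono[OF _ less_imp_le[OF K_pos]] simp del: times_divide_eq_left)
      then show "min b (a + K * v) \<in> {y..y + \<delta>}"
        using Kcd False y by auto
    qed
    finally show ?thesis using m by simp
  qed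
qed

end

text \<open>The one-arm weight is the tilt averaged over the reservoir. A constant mean is realised
  by a window of width \<delta> beside it, narrow enough that \<open>N\<close> rewards lose only a
  factor 2; taking \<delta> of order 1 / \<open>N\<close> makes the prepaid amount
  \<open>\<rho> * s0\<close> merely logarithmic.\<close>

lemma (in tilting) prob_bad_tilt:
  assumes \<mu>: "reservoir \<mu>" and alg: "measurable_alg ch out"
    and supp: "AE x in \<mu>. bern_mean \<theta>1 \<le> x \<and> x \<le> bern_mean \<theta>2"
    and w: "0 < w" "w \<le> 1"
    and window: "\<And>y \<delta>. bern_mean \<theta>1 \<le> y \<Longrightarrow> y \<le> bern_mean \<theta>2 \<Longrightarrow> 0 < \<delta> \<Longrightarrow> \<delta> \<le> 1 \<Longrightarrow>
      w * \<delta> \<le> measure \<mu> {y..y + \<delta>}"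
    and \<beta>: "bern_mean \<theta>1 < \<beta>" "\<beta> < 1"
    and \<delta>: "0 < \<delta>" "\<delta> < \<beta> - bern_mean \<theta>1" "N * \<delta> \<le> m / 2"
    and \<rho>_eq: "\<rho> * s0 = ln (1 + 2 / (w * \<delta>))"
    and S: "s0 * exp ((\<theta>2 - \<theta>1) / b) \<le> S"
  shows "w * ((\<beta> - bern_mean \<theta>1) / 2) * m ^ S * exp (- cost) ^ N \<le> prob_bad \<mu> \<beta> ch out N"
proof -
  let ?p1 = "bern_mean \<theta>1" and ?p2 = "bern_mean \<theta>2"
  interpret prob_space \<mu> using \<mu> by (simp add: reservoir_def)
  have sets_\<mu> [measurable_cong]: "sets \<mu> = sets borel" using \<mu> by (simp add: reservoir_def)
  have space_\<mu> [simp]: "space \<mu> = UNIV" using sets_eq_imp_space_eq[OF sets_\<mu>] by simp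
  have prob_UNIV [simp]: "prob UNIV = 1" using prob_space by simp
  define L :: "nat \<Rightarrow> nat \<Rightarrow> real \<Rightarrow> real" where "L k l x = x ^ k * (1 - x) ^ l" for k l x
  define \<Lambda> where "\<Lambda> k l = (\<integral>x. tilt x k l \<partial>\<mu>)" for k l
  have [measurable]: "L k l \<in> borel_measurable borel" for k l
    unfolding L_def by measurable
  have supp01: "0 \<le> x" "x \<le> 1" if "?p1 \<le> x" "x \<le> ?p2" for x
    using that m m_bounds by auto
  have L01: "0 \<le> L k l x" "L k l x \<le> 1" if "0 \<le> x" "x \<le> 1" for k l x
    using that by (auto simp: L_def intro!: mult_le_one power_le_one)
  have int_L: "integrable \<mu> (\<lambda>x. L k l x * indicator B x)" if "B \<in> sets borel" for k l B
  proof (rule integrable_const_bound[where B = 1])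
    show "AE x in \<mu>. norm (L k l x * indicator B x) \<le> 1"
      using supp by eventually_elim (use supp01 L01 in \<open>auto simp: indicator_def\<close>)
  qed (use that in measurable)
  have int_L': "integrable \<mu> (L k l)" for k l
    using int_L[of UNIV k l] by simp
  have int_ind: "integrable \<mu> (\<lambda>x. c * indicator B x)" if "B \<in> sets borel" for c :: real and B
    using that by (intro integrable_mult_right integrable_real_indicator)
      (simp_all add: sets_\<mu> emeasure_eq_measure)
  have int_tilt: "integrable \<mu> (\<lambda>x. tilt x k l)" for k l
  proof (rule integrable_const_bound[where B = 1])
    show "AE x in \<mu>. norm (tilt x k l) \<le> 1"
      using supp by eventually_elim (use tilt_nonneg tilt_le_1 in auto)
  qed measurable
  have L_ge_0: "0 \<le> (\<integral>x. L k l x \<partial>\<mu>)" for k l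
    by (intro integral_nonneg_AE eventually_mono[OF supp]) (use supp01 L01 in auto)
  have \<Lambda>_nonneg: "0 \<le> \<Lambda> k l" for k l
    unfolding \<Lambda>_def
    by (intro integral_nonneg_AE eventually_mono[OF supp]) (use tilt_nonneg in auto)
  have \<Lambda>_le_1: "\<Lambda> k l \<le> 1" for k l
  proof -
    have "\<Lambda> k l \<le> (\<integral>x. 1 \<partial>\<mu>)"
      unfolding \<Lambda>_def
      by (intro integral_mono_AE int_tilt eventually_mono[OF supp]) (use tilt_le_1 in auto)
    then show ?thesis by simp
  qed
  have \<delta>1: "\<delta> \<le> 1" using \<delta> \<beta> supp01[of ?p1] level_bounds[of 0] by linarith
  \<comment> \<open>Raising the mean from \<open>y\<close> helps the wins, and Bernoulli's
    inequality with \<open>l * \<delta> \<le> m / 2\<close> limits the harm to the losses to a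
    factor 2.\<close>
  have win: "w * \<delta> / 2 * L k l y \<le> (\<integral>x. L k l x * indicator {y..y + \<delta>} x \<partial>\<mu>)"
    if y: "?p1 \<le> y" "y \<le> ?p2" and kl: "k + l \<le> N" for k l y
  proof -
    have y01: "0 \<le> y" "m \<le> 1 - y" "y < 1" using y m m_bounds by auto
    have Ly: "0 \<le> L k l y" using y01 by (intro L01) auto
    have "l * \<delta> \<le> N * \<delta>" using kl \<delta> by (intro mult_right_mono) auto
    then have l\<delta>: "l * \<delta> \<le> m / 2" using \<delta>(3) by linarith
    have "(w * \<delta>) * (L k l y / 2) \<le> measure \<mu> {y..y + \<delta>} * (L k l y / 2)"
      using Ly window[OF y \<delta>(1) \<delta>1] by (intro mult_right_mono) auto
    also have "\<dots> = (\<integral>x. L k l y / 2 * indicator {y..y + \<delta>} x \<partial>\<mu>)"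
      by simp
    also have "\<dots> \<le> (\<integral>x. L k l x * indicator {y..y + \<delta>} x \<partial>\<mu>)"
    proof (intro integral_mono_AE int_L int_ind)
      show "AE x in \<mu>. L k l y / 2 * indicator {y..y + \<delta>} x \<le> L k l x * indicator {y..y + \<delta>} x"
        using supp
      proof eventually_elim
        case (elim x)
        have "L k l y / 2 \<le> L k l x" if x: "y \<le> x" "x \<le> y + \<delta>"
        proof (cases "l = 0")
          case True
          have "y ^ k \<le> x ^ k" using x y01 by (intro power_mono) auto
          moreover have "0 \<le> y ^ k" using y01 by simp
          ultimately show ?thesis using True by (simp add: L_def)
        next
          case False
          then have "\<delta> \<le> l * \<delta>" using \<delta> by simp
          then have \<delta>y: "\<delta> \<le> 1 - y" using l\<delta> y01 m_bounds by linarith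
          have "1 / 2 \<le> 1 + l * (- (\<delta> / (1 - y)))"
          proof -
            have "m / 2 \<le> (1 - y) / 2" using y01 by simp
            with l\<delta> have "l * \<delta> \<le> (1 - y) / 2" by (rule order.trans)
            then have "l * \<delta> / (1 - y) \<le> 1 / 2" using y01 by (simp add: field_simps)
            then show ?thesis by simp
          qed
          also have "\<dots> \<le> (1 + (- (\<delta> / (1 - y)))) ^ l"
            using \<delta>y y01 by (intro Bernoulli_inequality) auto
          finally have "(1 - y) ^ l * (1 / 2) \<le> (1 - y) ^ l * (1 + (- (\<delta> / (1 - y)))) ^ l"
            using y01 by (intro mult_left_mono) auto
          also have "\<dots> = (1 - y - \<delta>) ^ l"
            using y01 by (simp add: power_mult_distrib[symmetric] right_diff_distrib)
          also have "\<dots> \<le> (1 - x) ^ l"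
            using x \<delta>y by (intro power_mono) auto
          finally have "y ^ k * ((1 - y) ^ l * (1 / 2)) \<le> x ^ k * (1 - x) ^ l"
            using x y01 \<delta>y by (intro mult_mono power_mono) auto
          then show ?thesis by (simp add: L_def)
        qed
        then show ?case by (simp add: indicator_def)
      qed
    qed auto
    finally show ?thesis by simp
  qed
  \<comment> \<open>The completed prepayment. It covers 1 for arms that keep their mean plus
    \<open>2 / (w * \<delta>)\<close> for those moved to the current level.\<close>
  define \<omega> where "\<omega> = exp (- \<rho> * s0)"
  have wd: "0 < w * \<delta>" using w \<delta> by simp
  have \<omega>: "0 < \<omega>" "\<omega> * (1 + 2 / (w * \<delta>)) = 1"
  proof -
    have "exp (\<rho> * s0) = 1 + 2 / (w * \<delta>)"
      unfolding \<rho>_eq using wd by (intro exp_ln) (auto intro: add_pos_pos)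
    then show "\<omega> * (1 + 2 / (w * \<delta>)) = 1"
      by (metis \<omega>_def exp_minus_inverse mult.commute mult_minus_left)
  qed (simp add: \<omega>_def)
  have \<Lambda>_L: "\<Lambda> k l \<le> (\<integral>x. L k l x \<partial>\<mu>)" if kl: "k + l \<le> N" for k l
  proof (cases "k + l \<le> s0")
    case True
    show ?thesis
      unfolding \<Lambda>_def
    proof (intro integral_mono_AE int_tilt int_L')
      show "AE x in \<mu>. tilt x k l \<le> L k l x"
        using supp
      proof eventually_elim
        case (elim x)
        have f: "x = min x (level (k + l))" using elim level_early[OF True] by simp
        have "tilt x k l \<le> L k l x * exp (- \<rho> * min (k + l) s0)"
          unfolding L_def using elim f by (intro tilt_le) auto
        also have "\<dots> \<le> L k l x * 1"
          using \<rho> L01[of x k l] elim supp01[of x] by (intro mult_left_mono) auto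
        finally show ?case by simp
      qed
    qed
  next
    case False
    let ?y = "level (k + l)"
    have y: "?p1 \<le> ?y" "?y \<le> ?p2" by (rule level_bounds)+
    have Ly: "0 \<le> L k l ?y" using supp01[OF y] by (rule L01)
    \<comment> \<open>The minimum of \<open>x\<close> and the level is one of the two, so its
      likelihood is at most the sum of both.\<close>
    have "\<Lambda> k l \<le> (\<integral>x. \<omega> * (L k l x + L k l ?y) \<partial>\<mu>)"
      unfolding \<Lambda>_def
    proof (intro integral_mono_AE int_tilt)
      show "AE x in \<mu>. tilt x k l \<le> \<omega> * (L k l x + L k l ?y)"
        using supp
      proof eventually_elim
        case (elim x)
        let ?f = "min x ?y"
        have "tilt x k l \<le> L k l ?f * exp (- \<rho> * min (k + l) s0)"
          unfolding L_def using elim by (intro tilt_le) auto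
        also have "min (k + l) s0 = s0" using False by simp
        also have "L k l ?f * exp (- \<rho> * s0) \<le> (L k l x + L k l ?y) * exp (- \<rho> * s0)"
          using L01[of x k l] Ly elim supp01[of x] by (intro mult_right_mono) (auto simp: min_def)
        finally show ?case by (simp add: \<omega>_def mult.commute)
      qed
    qed (auto intro!: int_L')
    also have "\<dots> = \<omega> * ((\<integral>x. L k l x \<partial>\<mu>) + L k l ?y)"
      by (simp add: int_L')
    also have "\<dots> \<le> \<omega> * ((\<integral>x. L k l x \<partial>\<mu>) + 2 / (w * \<delta>) * (\<integral>x. L k l x \<partial>\<mu>))"
    proof -
      have "w * \<delta> / 2 * L k l ?y \<le> (\<integral>x. L k l x * indicator {?y..?y + \<delta>} x \<partial>\<mu>)"
        by (rule win[OF y kl])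
      also have "\<dots> \<le> (\<integral>x. L k l x \<partial>\<mu>)"
      proof (intro integral_mono_AE int_L int_L')
        show "AE x in \<mu>. L k l x * indicator {?y..?y + \<delta>} x \<le> L k l x"
          using supp by eventually_elim (use supp01 L01 in \<open>auto simp: indicator_def\<close>)
      qed auto
      finally have "L k l ?y \<le> 2 / (w * \<delta>) * (\<integral>x. L k l x \<partial>\<mu>)"
        using w \<delta> by (simp add: field_simps)
      then show ?thesis using \<omega> by (intro mult_left_mono add_left_mono) auto
    qed
    also have "\<dots> = (\<omega> * (1 + 2 / (w * \<delta>))) * (\<integral>x. L k l x \<partial>\<mu>)"
      by (simp add: algebra_simps)
    finally show ?thesis using \<omega> by simp
  qed
  let ?\<theta> = "w * ((\<beta> - ?p1) / 2) * m ^ S"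
  have p1: "0 \<le> ?p1" "?p1 \<le> ?p2" using m m_bounds level_bounds[of 0] by auto
  have mS: "0 \<le> m ^ S" "m ^ S \<le> 1" using m_bounds by (auto intro: power_le_one)
  have \<theta>0: "0 \<le> ?\<theta>" using w \<beta> mS by (intro mult_nonneg_nonneg) auto
  have \<theta>1: "?\<theta> \<le> 1" using w \<beta> mS p1 by (intro mult_le_one mult_nonneg_nonneg) auto
  have \<Lambda>_bad: "?\<theta> * \<Lambda> k l \<le> (\<integral>x. L k l x * indicator {..<\<beta>} x \<partial>\<mu>)" if kl: "k + l \<le> N" for k l
  proof (cases "S \<le> k + l")
    case True
    then have late: "level (k + l) = ?p1"
      using S by (intro level_late) linarith
    have "real s0 * 1 \<le> s0 * exp ((\<theta>2 - \<theta>1) / b)"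
      using \<theta> b by (intro mult_left_mono) auto
    then have s0_le: "s0 \<le> k + l" using True S by linarith
    \<comment> \<open>The level has reached the bottom of the support, so almost every mean is moved
      to \<open>?p1\<close>, and the window beside \<open>?p1\<close> lies below \<beta>.\<close>
    have "\<Lambda> k l \<le> (\<integral>x. \<omega> * L k l ?p1 \<partial>\<mu>)"
      unfolding \<Lambda>_def
    proof (intro integral_mono_AE int_tilt)
      show "AE x in \<mu>. tilt x k l \<le> \<omega> * L k l ?p1"
        using supp
      proof eventually_elim
        case (elim x)
        have "tilt x k l \<le> L k l ?p1 * exp (- \<rho> * min (k + l) s0)"
          unfolding L_def using elim late by (intro tilt_le) auto
        also have "min (k + l) s0 = s0" using s0_le by simp
        finally show ?case by (simp add: \<omega>_def mult.commute)
      qed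
    qed simp
    also have "\<dots> = \<omega> * L k l ?p1" by simp
    also have "\<dots> \<le> \<omega> * (2 / (w * \<delta>) * (\<integral>x. L k l x * indicator {?p1..?p1 + \<delta>} x \<partial>\<mu>))"
    proof -
      have "L k l ?p1 \<le> 2 / (w * \<delta>) * (\<integral>x. L k l x * indicator {?p1..?p1 + \<delta>} x \<partial>\<mu>)"
        using win[OF order.refl p1(2) kl] w \<delta> by (simp add: field_simps)
      then show ?thesis using \<omega> by (intro mult_left_mono) auto
    qed
    also have "\<dots> = (\<omega> * (2 / (w * \<delta>))) * (\<integral>x. L k l x * indicator {?p1..?p1 + \<delta>} x \<partial>\<mu>)"
      by simp
    also have "\<dots> \<le> 1 * (\<integral>x. L k l x * indicator {..<\<beta>} x \<partial>\<mu>)"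
    proof (intro mult_mono)
      show "\<omega> * (2 / (w * \<delta>)) \<le> 1" using \<omega> by (simp add: distrib_left)
      show "(\<integral>x. L k l x * indicator {?p1..?p1 + \<delta>} x \<partial>\<mu>) \<le> (\<integral>x. L k l x * indicator {..<\<beta>} x \<partial>\<mu>)"
      proof (intro integral_mono_AE int_L)
        show "AE x in \<mu>. L k l x * indicator {?p1..?p1 + \<delta>} x \<le> L k l x * indicator {..<\<beta>} x"
          using supp by eventually_elim (use supp01 L01 \<delta> in \<open>auto simp: indicator_def\<close>)
      qed auto
      show "0 \<le> (\<integral>x. L k l x * indicator {?p1..?p1 + \<delta>} x \<partial>\<mu>)"
        by (intro integral_nonneg_AE eventually_mono[OF supp]) (use supp01 L01 in auto)
    qed simp
    finally have "\<Lambda> k l \<le> (\<integral>x. L k l x * indicator {..<\<beta>} x \<partial>\<mu>)" by simp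
    moreover have "?\<theta> * \<Lambda> k l \<le> 1 * \<Lambda> k l"
      using \<theta>1 \<Lambda>_nonneg by (rule mult_right_mono)
    ultimately show ?thesis by simp
  next
    case False
    \<comment> \<open>A fixed piece of the reservoir below \<beta>. For means between
      \<open>m\<close> and \<open>1 - m\<close>, fewer than \<open>S\<close> rewards have likelihood
      at least \<open>m ^ S\<close>, whatever they are, and the weight being replaced is at most
      1.\<close>
    let ?I = "{?p1..?p1 + (\<beta> - ?p1) / 2}"
    have "?\<theta> * \<Lambda> k l \<le> ?\<theta> * 1"
      using \<theta>0 \<Lambda>_le_1 by (rule mult_left_mono[rotated])
    also have "\<dots> \<le> measure \<mu> ?I * m ^ S"
    proof -
      have "w * ((\<beta> - ?p1) / 2) \<le> measure \<mu> ?I"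
        using \<beta> p1 by (intro window) auto
      from mult_right_mono[OF this mS(1)] show ?thesis by simp
    qed
    also have "\<dots> = (\<integral>x. m ^ S * indicator ?I x \<partial>\<mu>)"
      by simp
    also have "\<dots> \<le> (\<integral>x. L k l x * indicator {..<\<beta>} x \<partial>\<mu>)"
    proof (intro integral_mono_AE int_L int_ind)
      show "AE x in \<mu>. m ^ S * indicator ?I x \<le> L k l x * indicator {..<\<beta>} x"
        using supp
      proof eventually_elim
        case (elim x)
        have x: "m \<le> x" "m \<le> 1 - x" using elim m by auto
        have "m ^ S \<le> m ^ (k + l)"
          using False m_bounds by (intro power_decreasing) auto
        also have "\<dots> = m ^ k * m ^ l" by (rule power_add)
        also have "\<dots> \<le> L k l x"
          unfolding L_def using x m_bounds by (intro mult_mono power_mono) auto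
        finally have "m ^ S \<le> L k l x" .
        moreover have "x < \<beta>" if "x \<in> ?I"
          using that \<beta> by (simp add: field_simps)
        moreover have "0 \<le> L k l x" using x m_bounds by (intro L01) auto
        ultimately show ?case by (auto simp: indicator_def)
      qed
    qed auto
    finally show ?thesis .
  qed
  show ?thesis
  proof (rule prob_bad_ge[where \<Lambda> = \<Lambda>, OF \<mu> alg _ \<Lambda>_nonneg _ _ _ _ \<theta>0])
    show "\<Lambda> 0 0 = 1" by (simp add: \<Lambda>_def tilt_0)
    show "exp (- cost) * \<Lambda> k l \<le> \<Lambda> (Suc k) l + \<Lambda> k (Suc l)" for k l
    proof -
      have "(\<integral>x. exp (- cost) * tilt x k l \<partial>\<mu>) \<le> (\<integral>x. tilt x (Suc k) l + tilt x k (Suc l) \<partial>\<mu>)"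
        by (intro integral_mono_AE Bochner_Integration.integrable_add integrable_mult_right int_tilt
            eventually_mono[OF supp]) (use tilt_submartingale in auto)
      then show ?thesis by (simp add: \<Lambda>_def int_tilt)
    qed
    show "\<Lambda> k l \<le> (\<integral>x. x ^ k * (1 - x) ^ l \<partial>\<mu>)" if "k + l \<le> N" for k l
      using \<Lambda>_L[OF that] by (simp add: L_def)
    show "?\<theta> * \<Lambda> k l \<le> (\<integral>x. x ^ k * (1 - x) ^ l * indicator {..<\<beta>} x \<partial>\<mu>)" if "k + l \<le> N" for k l
      using \<Lambda>_bad[OF that] by (simp add: L_def)
  qed simp
qed

section \<open>Asymptotics\<close>

text \<open>With \<open>s0\<close> of order ln^4 x and \<open>A\<close> = ln x, each term of the
  cost beyond the first is at most of order 1 / ln^3 x, and the price of moving the output arm is of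
  lower order than x / ln^2 x because \<open>\<zeta> < 1\<close>.\<close>

lemma rate_bound_tendsto:
  fixes c e D \<zeta> m q :: real
  assumes "0 < c" "0 < e" "0 < D" "0 < \<zeta>" "\<zeta> < 1" "0 < m" "0 < q"
  shows "((\<lambda>x. (c + ((ln x ^ 4 + 1) * x powr \<zeta> + 1) * e
      + x * ((D / (\<zeta> * ln x))\<^sup>2 / 2 * (1 + D / (\<zeta> * ln x) / m)\<^sup>2 + (D / (\<zeta> * ln x)) ^ 3 / m\<^sup>2
        + (D / (\<zeta> * ln x))\<^sup>2 / (ln x ^ 4 * m\<^sup>2) + 2 * (D / (\<zeta> * ln x))\<^sup>2 / (ln x * m\<^sup>2)
        + ln x / ln x ^ 4 + ln (1 + q * x) / ln x ^ 4)) * (ln x)\<^sup>2 / x)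
    \<longlongrightarrow> (D / \<zeta>)\<^sup>2 / 2) at_top"
  unfolding divide_inverse[of D \<zeta>] using assms by real_asymp

text \<open>The bound holds for all large \<open>N\<close>, not just along a subsequence. The slack,
  and with it the reservoir, is fixed before \<open>N\<close> and the algorithm; only the tilt
  varies with \<open>N\<close>.\<close>

lemma rate_le_const:
  fixes lam \<eta> \<alpha> \<beta> :: real
  assumes lam: "0 < lam" and \<eta>: "0 < \<eta>" "\<eta> < 1" and \<alpha>\<beta>: "0 < \<beta>" "\<beta> < \<alpha>" "\<alpha> < 1"
  obtains \<mu> where "reservoir \<mu>" "Ginv \<mu> (1 - \<eta>) = \<alpha>"
    "\<And>ch out. (\<And>N. measurable_alg (ch N) (out N)) \<Longrightarrow>
      eventually (\<lambda>N. rate \<mu> \<beta> (ch N) (out N) N \<le> ereal (c_const \<alpha> \<beta> + lam)) sequentially"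
proof -
  define \<theta>2 \<theta>\<beta> where "\<theta>2 = arccos (1 - 2 * \<alpha>)" and "\<theta>\<beta> = arccos (1 - 2 * \<beta>)"
  have \<theta>: "0 < \<theta>\<beta>" "\<theta>\<beta> < \<theta>2" "\<theta>2 < pi"
    using \<alpha>\<beta> arccos_lt_bounded[of "1 - 2 * \<alpha>"] arccos_lt_bounded[of "1 - 2 * \<beta>"]
      arccos_less_arccos[of "1 - 2 * \<alpha>" "1 - 2 * \<beta>"]
    by (auto simp: \<theta>2_def \<theta>\<beta>_def)
  have mean: "bern_mean \<theta>2 = \<alpha>" "bern_mean \<theta>\<beta> = \<beta>"
    using \<alpha>\<beta> by (simp_all add: bern_mean_def \<theta>2_def \<theta>\<beta>_def)
  \<comment> \<open>One \<epsilon> serves both slacks, the end angle below that of \<beta> and the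
    exponent \<open>1 - \<epsilon>\<close>; by continuity their joint price is below
    \<open>lam\<close>.\<close>
  have "((\<lambda>\<epsilon>. ((\<theta>2 - (\<theta>\<beta> - \<epsilon>)) / (1 - \<epsilon>))\<^sup>2 / 2) \<longlongrightarrow> ((\<theta>2 - (\<theta>\<beta> - 0)) / (1 - 0))\<^sup>2 / 2) (at_right 0)"
    by (intro tendsto_intros) auto
  then have "eventually (\<lambda>\<epsilon>. ((\<theta>2 - (\<theta>\<beta> - \<epsilon>)) / (1 - \<epsilon>))\<^sup>2 / 2 < c_const \<alpha> \<beta> + lam) (at_right 0)"
    using lam by (intro order_tendstoD) (auto simp: c_const_def \<theta>2_def \<theta>\<beta>_def)
  moreover have "eventually (\<lambda>\<epsilon>. \<epsilon> < min 1 \<theta>\<beta>) (at_right 0)"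
    by (rule order_tendstoD(2)[OF tendsto_ident_at]) (use \<theta> in simp)
  moreover have "eventually (\<lambda>\<epsilon>. (0::real) < \<epsilon>) (at_right 0)"
    by (rule eventually_at_right_less)
  ultimately have "eventually (\<lambda>\<epsilon>. ((\<theta>2 - (\<theta>\<beta> - \<epsilon>)) / (1 - \<epsilon>))\<^sup>2 / 2 < c_const \<alpha> \<beta> + lam
      \<and> \<epsilon> < min 1 \<theta>\<beta> \<and> 0 < \<epsilon>) (at_right 0)"
    by eventually_elim auto
  then obtain \<epsilon> where \<epsilon>: "((\<theta>2 - (\<theta>\<beta> - \<epsilon>)) / (1 - \<epsilon>))\<^sup>2 / 2 < c_const \<alpha> \<beta> + lam"
    "\<epsilon> < 1" "\<epsilon> < \<theta>\<beta>" "0 < \<epsilon>"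
    by (auto dest: eventually_happens)
  define \<theta>1 \<zeta> D where "\<theta>1 = \<theta>\<beta> - \<epsilon>" and "\<zeta> = 1 - \<epsilon>" and "D = \<theta>2 - \<theta>1"
  have \<theta>1: "0 < \<theta>1" "\<theta>1 < \<theta>\<beta>" "\<theta>1 < \<theta>2" and \<zeta>: "0 < \<zeta>" "\<zeta> < 1" and D: "0 < D"
    using \<epsilon> \<theta> by (auto simp: \<theta>1_def \<zeta>_def D_def)
  have lim_less: "(D / \<zeta>)\<^sup>2 / 2 < c_const \<alpha> \<beta> + lam"
    using \<epsilon> by (simp add: D_def \<theta>1_def \<zeta>_def)
  define p1 where "p1 = bern_mean \<theta>1"
  have p1: "0 < p1" "p1 < \<beta>"
  proof -
    have "cos \<theta>1 < cos 0" "cos \<theta>\<beta> < cos \<theta>1"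
      using \<theta>1 \<theta> by (auto intro!: cos_monotone_0_pi simp del: cos_zero)
    then show "0 < p1" "p1 < \<beta>" using mean by (auto simp: p1_def bern_mean_def)
  qed
  define m where "m = min p1 (1 - \<alpha>)"
  have m: "0 < m" "m \<le> p1" "\<alpha> \<le> 1 - m" "m < 1" using p1 \<alpha>\<beta> by (auto simp: m_def)
  define \<mu> where "\<mu> = uniform_with_atom p1 \<alpha> \<eta>"
  define w where "w = min (1 / ((\<alpha> - p1) / (1 - \<eta>))) \<eta>"
  have ab: "0 \<le> p1" "p1 < \<alpha>" "\<alpha> \<le> 1" using p1 \<alpha>\<beta> by auto
  have w: "0 < w" "w \<le> 1" using ab \<eta> by (auto simp: w_def)
  \<comment> \<open>\<open>c\<close> is the price of the fixed mass below \<beta>, \<open>e\<close>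
    the price per pull of moving the output arm, and \<open>q\<close> turns
    \<open>2 / (w * \<delta>)\<close> into \<open>q * N\<close>.\<close>
  define c e q where "c = - ln (w * ((\<beta> - p1) / 2))" and "e = - ln m"
    and "q = 2 / (w * min ((\<beta> - p1) / 2) (m / 2))"
  have w\<beta>: "0 < w * ((\<beta> - p1) / 2)" "w * ((\<beta> - p1) / 2) < 1"
  proof -
    show "0 < w * ((\<beta> - p1) / 2)" using w p1 by (intro mult_pos_pos) auto
    have "w * ((\<beta> - p1) / 2) \<le> 1 * ((\<beta> - p1) / 2)" using w p1 by (intro mult_right_mono) auto
    also have "\<dots> < 1" using p1 \<alpha>\<beta> by simp
    finally show "w * ((\<beta> - p1) / 2) < 1" .
  qed
  have pos: "0 < c" "0 < e" "0 < q"
    using w\<beta> m w p1 by (auto simp: c_def e_def q_def intro!: divide_pos_pos mult_pos_pos)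
  define U where "U x = (c + ((ln x ^ 4 + 1) * x powr \<zeta> + 1) * e
      + x * ((D / (\<zeta> * ln x))\<^sup>2 / 2 * (1 + D / (\<zeta> * ln x) / m)\<^sup>2 + (D / (\<zeta> * ln x)) ^ 3 / m\<^sup>2
        + (D / (\<zeta> * ln x))\<^sup>2 / (ln x ^ 4 * m\<^sup>2) + 2 * (D / (\<zeta> * ln x))\<^sup>2 / (ln x * m\<^sup>2)
        + ln x / ln x ^ 4 + ln (1 + q * x) / ln x ^ 4)) * (ln x)\<^sup>2 / x" for x
  have "(U \<longlongrightarrow> (D / \<zeta>)\<^sup>2 / 2) at_top"
    unfolding U_def using pos D \<zeta> m by (intro rate_bound_tendsto)
  then have "((\<lambda>N. U (real N)) \<longlongrightarrow> (D / \<zeta>)\<^sup>2 / 2) sequentially"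
    by (rule filterlim_compose[OF _ filterlim_real_sequentially])
  then have U_less: "eventually (\<lambda>N. U (real N) < c_const \<alpha> \<beta> + lam) sequentially"
    using lim_less by (rule order_tendstoD)
  have b_less: "eventually (\<lambda>N. D / (\<zeta> * ln (real N)) < m) sequentially"
    using D \<zeta> m by real_asymp
  have rate_U: "rate \<mu> \<beta> ch out N \<le> ereal (U (real N))"
    if N: "3 \<le> N" and b: "D / (\<zeta> * ln (real N)) < m" and alg: "measurable_alg ch out" for N ch out
  proof -
    define l where "l = ln (real N)"
    have l: "0 < l" using N by (simp add: l_def)
    define s0 where "s0 = nat \<lceil>l ^ 4\<rceil>"
    have l4: "0 < l ^ 4" using l by simp
    \<comment> \<open>The lower estimate serves the divisions by \<open>s0\<close>, the upper one
      the length \<open>S\<close> of the trajectory.\<close>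
    have s0: "l ^ 4 \<le> s0" "s0 \<le> l ^ 4 + 1" using l4 unfolding s0_def by linarith+
    then have s0_pos: "0 < real s0" using l4 by linarith
    define \<delta> where "\<delta> = min ((\<beta> - p1) / 2) (m / 2) / N"
    have qN: "2 / (w * \<delta>) = q * N" by (simp add: \<delta>_def q_def)
    define \<rho> where "\<rho> = ln (1 + q * N) / s0"
    have ln_pos: "0 \<le> ln (1 + q * N)" using pos by simp
    let ?b = "D / (\<zeta> * l)"
    have b_pos: "0 < ?b" using D \<zeta> l by simp
    interpret T: tilting \<theta>1 \<theta>2 ?b l \<rho> m s0
      using \<theta>1 \<theta> b b_pos l m s0_pos ln_pos mean
      by unfold_locales (auto simp: \<rho>_def p1_def[symmetric] l_def)
    define S where "S = nat \<lceil>s0 * exp (D / ?b)\<rceil>"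
    have "0 \<le> s0 * exp (D / ?b)" by simp
    then have S: "s0 * exp (D / ?b) \<le> S" "S \<le> s0 * exp (D / ?b) + 1"
      unfolding S_def by linarith+
    \<comment> \<open>The speed \<open>?b\<close> is chosen so that the angle distance
      \<open>D\<close> is used up exactly after \<open>s0 * real N powr \<zeta>\<close>
      pulls.\<close>
    have "exp (D / ?b) = real N powr \<zeta>"
      using D N by (simp add: powr_def l_def)
    then have S_le: "S \<le> (l ^ 4 + 1) * real N powr \<zeta> + 1"
      using S(2) s0(2) mult_right_mono[OF s0(2), of "real N powr \<zeta>"] by simp
    have "N * \<delta> = min ((\<beta> - p1) / 2) (m / 2)" using N by (simp add: \<delta>_def)
    then have N\<delta>: "N * \<delta> \<le> m / 2" by simp
    have \<delta>: "0 < \<delta>" "\<delta> < \<beta> - p1"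
    proof -
      show "0 < \<delta>" using N p1 m by (simp add: \<delta>_def)
      then have "1 * \<delta> \<le> N * \<delta>" using N by (intro mult_right_mono) auto
      then show "\<delta> < \<beta> - p1"
        using \<open>N * \<delta> = min ((\<beta> - p1) / 2) (m / 2)\<close> p1 by (auto simp: min_def split: if_splits)
    qed
    have P_ge: "w * ((\<beta> - p1) / 2) * m ^ S * exp (- T.cost) ^ N \<le> prob_bad \<mu> \<beta> ch out N" (is "?L \<le> ?P")
      unfolding p1_def
    proof (rule T.prob_bad_tilt[OF _ alg _ w])
      show "reservoir \<mu>"
        unfolding \<mu>_def by (rule reservoir_uniform_with_atom[OF ab \<eta>])
      show "AE x in \<mu>. bern_mean \<theta>1 \<le> x \<and> x \<le> bern_mean \<theta>2"
        unfolding \<mu>_def mean p1_def[symmetric] by (rule AE_uniform_with_atom[OF ab \<eta>])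
      show "w * d \<le> measure \<mu> {y..y + d}"
        if "bern_mean \<theta>1 \<le> y" "y \<le> bern_mean \<theta>2" "0 < d" "d \<le> 1" for y d
        using uniform_with_atom_window[OF ab \<eta>, of y d] that
        by (simp add: \<mu>_def w_def mean p1_def[symmetric])
      show "\<rho> * s0 = ln (1 + 2 / (w * \<delta>))"
        unfolding qN \<rho>_def using s0_pos by simp
      show "s0 * exp ((\<theta>2 - \<theta>1) / ?b) \<le> S"
        using S(1) by (simp add: D_def)
    qed (use p1 \<alpha>\<beta> \<delta> N\<delta> in \<open>auto simp: p1_def\<close>)
    have L_pos: "0 < ?L" by (intro mult_pos_pos[OF mult_pos_pos[OF w\<beta>(1) zero_less_power[OF m(1)]]]) simp
    have "- ln (a * m ^ S * exp (- x) ^ N) = - ln a + S * - ln m + real N * x" if "0 < a" for a x :: real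
      using that m by (simp add: ln_mult ln_realpow)
    from this[OF w\<beta>(1)] have lnL: "- ln ?L = c + S * e + N * T.cost"
      unfolding c_def e_def .
    have P_pos: "0 < ?P" using L_pos P_ge by linarith
    have "- ln ?P \<le> - ln ?L" using L_pos P_ge by simp
    also have "\<dots> \<le> c + ((l ^ 4 + 1) * real N powr \<zeta> + 1) * e
        + N * (?b\<^sup>2 / 2 * (1 + ?b / m)\<^sup>2 + ?b ^ 3 / m\<^sup>2 + ?b\<^sup>2 / (l ^ 4 * m\<^sup>2) + 2 * ?b\<^sup>2 / (l * m\<^sup>2)
          + l / l ^ 4 + ln (1 + q * N) / l ^ 4)"
      unfolding lnL unfolding T.cost_def unfolding \<rho>_def
      using S_le s0 s0_pos l4 l m pos ln_pos
      by (intro add_mono mult_right_mono mult_left_mono order.refl divide_left_mono mult_pos_pos;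
          (assumption | linarith | simp))
    finally have "(- ln ?P) * (ln (real N))\<^sup>2 / N \<le> U N"
      unfolding U_def l_def by (intro divide_right_mono mult_right_mono) auto
    then show ?thesis
      using P_pos by (simp add: rate_def Let_def)
  qed
  show ?thesis
  proof (rule that[of \<mu>])
    show "reservoir \<mu>"
      unfolding \<mu>_def by (rule reservoir_uniform_with_atom[OF ab \<eta>])
    show "Ginv \<mu> (1 - \<eta>) = \<alpha>"
      unfolding \<mu>_def by (rule Ginv_uniform_with_atom[OF ab \<eta>])
    fix ch out :: "nat \<Rightarrow> real \<Rightarrow> (nat \<times> bool) list \<Rightarrow> nat"
    assume alg: "\<And>N. measurable_alg (ch N) (out N)"
    show "eventually (\<lambda>N. rate \<mu> \<beta> (ch N) (out N) N \<le> ereal (c_const \<alpha> \<beta> + lam)) sequentially"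
      using U_less b_less eventually_ge_at_top[of 3]
    proof eventually_elim
      case (elim N)
      then have "rate \<mu> \<beta> (ch N) (out N) N \<le> ereal (U (real N))"
        by (intro rate_U alg)
      also have "\<dots> \<le> ereal (c_const \<alpha> \<beta> + lam)" using elim by simp
      finally show ?case .
    qed
  qed
qed

theorem theorem1p8:
  fixes lam \<eta> \<alpha> \<beta> :: real
  assumes "0 < lam" "lam < 1" "0 < \<eta>" "\<eta> < 1" "0 < \<beta>" "\<beta> < \<alpha>" "\<alpha> < 1"
  shows "\<exists>\<mu>. reservoir \<mu> \<and> Ginv \<mu> (1 - \<eta>) = \<alpha> \<and>
    (\<forall>ch out :: nat \<Rightarrow> real \<Rightarrow> (nat \<times> bool) list \<Rightarrow> nat.
       (\<forall>N. measurable_alg (ch N) (out N)) \<longrightarrow>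
       liminf (\<lambda>N. rate \<mu> \<beta> (ch N) (out N) N) \<le> ereal (c_const \<alpha> \<beta> + lam))"
proof -
  obtain \<mu> where \<mu>: "reservoir \<mu>" "Ginv \<mu> (1 - \<eta>) = \<alpha>"
    and bound: "\<And>ch out. (\<And>N. measurable_alg (ch N) (out N)) \<Longrightarrow>
      eventually (\<lambda>N. rate \<mu> \<beta> (ch N) (out N) N \<le> ereal (c_const \<alpha> \<beta> + lam)) sequentially"
    using rate_le_const[of lam \<eta> \<beta> \<alpha>] assms by blast
  have "liminf (\<lambda>N. rate \<mu> \<beta> (ch N) (out N) N) \<le> ereal (c_const \<alpha> \<beta> + lam)"
    if "\<forall>N. measurable_alg (ch N) (out N)" for ch out
  proof -
    have "liminf (\<lambda>N. rate \<mu> \<beta> (ch N) (out N) N) \<le> limsup (\<lambda>N. rate \<mu> \<beta> (ch N) (out N) N)"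
      by (rule Liminf_le_Limsup) simp
    also have "\<dots> \<le> ereal (c_const \<alpha> \<beta> + lam)"
      using bound[of ch out] that by (intro Limsup_bounded) auto
    finally show ?thesis .
  qed
  with \<mu> show ?thesis by blast
qed

end
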